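(* Let $n\ge 2$ be an integer, let $\alpha>0$, $\beta>0$ and $1\le p<\infty$, and suppose that the operator $P_\alpha$ is bounded on $L^p(\mathbb{R}^n,d\mu_\beta)$. Then $2\alpha=p\beta$.
   Context: For $\alpha>0$ let $d\mu_\alpha(y)=(\pi\alpha)^{-n/2}e^{-|y|^2/\alpha}\,dy$, a probability measure on $\mathbb{R}^n$. The harmonic Fock space $\mathcal{H}_\alpha^2$ is the space of all harmonic functions on $\mathbb{R}^n$ belonging to $L^2(\mathbb{R}^n,d\mu_\alpha)$, and $H_\alpha(x,y)$ denotes its reproducing kernel. Explicitly, $$H_\alpha(x,y)=\sum_{k=0}^\infty\frac{Y_k(x,y)}{\alpha^k\,(n/2)_k},\qquad x,y\in\mathbb{R}^n,$$ where $(a)_k=a(a+1)\cdots(a+k-1)$ is the Pochhammer symbol (with $(a)_0=1$), $Y_0\equiv 1$, and for $k\ge1$, $Y_k(x,y)=|x|^k|y|^k\,\mathcal{Y}_k\!\left(\frac{x}{|x|},\frac{y}{|y|}\right)$ (interpreted as $0$ if $x=0$ or $y=0$). Here $\mathcal{Y}_k(\cdot,\eta)$ is the zonal harmonic of degree $k$ with pole $\eta\in\mathbb{S}^{n-1}$, i.e. the spherical harmonic of degree $k$ such that $p(\eta)=\int_{\mathbb{S}^{n-1}}p(\xi)\overline{\mathcal{Y}_k(\xi,\eta)}\,d\sigma'(\xi)$ for every spherical harmonic $p$ of degree $k$, where $\sigma'$ is the normalized surface measure on $\mathbb{S}^{n-1}$. The operator $P_\alpha$ is the integral operator $$P_\alpha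 f(x)=\int_{\mathbb{R}^n}H_\alpha(x,y)f(y)\,d\mu_\alpha(y),$$ which on $L^2(\mathbb{R}^n,d\mu_\alpha)$ is the orthogonal projection onto $\mathcal{H}_\alpha^2$. "$P_\alpha$ is bounded on $L^p(\mathbb{R}^n,d\mu_\beta)$" means that this integral operator maps $L^p(\mathbb{R}^n,d\mu_\beta)$ into itself and there is a constant $C$ with $\int|P_\alpha f|^p\,d\mu_\beta\le C\int|f|^p\,d\mu_\beta$ for all $f\in L^p(\mathbb{R}^n,d\mu_\beta)$. *)

theory Defs
  imports "HOL-Analysis.Analysis"
begin

definition gauss_measure :: "real \<Rightarrow> (real ^ 'n) measure" where
  "gauss_measure \<alpha> =
     density lborel
       (\<lambda>y. ennreal ((pi * \<alpha>) powr (- real CARD('n) / 2) * exp (- (norm y)\<^sup>2 / \<alpha>)))"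

(* The normalized surface measure in polar coordinates: a set A on the unit sphere gets the
   normalized volume of the cone of all r * x with x in A and 0 < r <= 1.  It is a Borel measure
   on the whole space, concentrated on the sphere (the origin, where the radial projection
   degenerates, is a null set). *)
definition sphere_measure :: "(real ^ 'n) measure" where
  "sphere_measure = distr (uniform_measure lborel (cball 0 1)) borel (\<lambda>x. x /\<^sub>R norm x)"

definition partial_deriv :: "real ^ 'n \<Rightarrow> (real ^ 'n \<Rightarrow> complex) \<Rightarrow> real ^ 'n \<Rightarrow> complex" where
  "partial_deriv e f x = vector_derivative (\<lambda>t. f (x + t *\<^sub>R e)) (at 0)"

definition laplacian :: "(real ^ 'n \<Rightarrow> complex) \<Rightarrow> real ^ 'n \<Rightarrow> complex" where
  "laplacian f x = (\<Sum>e\<in>Basis. partial_deriv e (partial_deriv e f) x)"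

definition homogeneous_harmonic_polynomials :: "nat \<Rightarrow> (real ^ 'n \<Rightarrow> complex) set" where
  "homogeneous_harmonic_polynomials k =
     {q. polynomial_function q \<and> (\<forall>c x. q (c *\<^sub>R x) = of_real (c ^ k) * q x) \<and>
         (\<forall>x. laplacian q x = 0)}"

(* Spherical harmonics are functions on the sphere only; \<open>restrict\<close> makes their values off the
   sphere irrelevant, so that the zonal harmonic below is unique as a function. *)
definition spherical_harmonics :: "nat \<Rightarrow> (real ^ 'n \<Rightarrow> complex) set" where
  "spherical_harmonics k =
     (\<lambda>q. restrict q (sphere 0 1)) ` homogeneous_harmonic_polynomials k"

(* \<open>zonal_harmonic k \<eta>\<close> is the zonal harmonic with pole \<open>\<eta>\<close>, that is, the pole comes first. *)
definition zonal_harmonic :: "nat \<Rightarrow> real ^ 'n \<Rightarrow> real ^ 'n \<Rightarrow> complex" where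
  "zonal_harmonic k \<eta> =
     (THE Z. Z \<in> spherical_harmonics k \<and>
        (\<forall>p\<in>spherical_harmonics k. p \<eta> = (\<integral>\<xi>. p \<xi> * cnj (Z \<xi>) \<partial>sphere_measure)))"

definition solid_zonal_harmonic :: "nat \<Rightarrow> real ^ 'n \<Rightarrow> real ^ 'n \<Rightarrow> complex" where
  "solid_zonal_harmonic k x y =
     (if k = 0 then 1
      else if x = 0 \<or> y = 0 then 0
      else of_real (norm x ^ k * norm y ^ k) * zonal_harmonic k (y /\<^sub>R norm y) (x /\<^sub>R norm x))"

definition harmonic_Fock_kernel :: "real \<Rightarrow> real ^ 'n \<Rightarrow> real ^ 'n \<Rightarrow> complex" where
  "harmonic_Fock_kernel \<alpha> x y =
     (\<Sum>k. solid_zonal_harmonic k x y / of_real (\<alpha> ^ k * pochhammer (real CARD('n) / 2) k))"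

definition harmonic_Fock_projection ::
    "real \<Rightarrow> (real ^ 'n \<Rightarrow> complex) \<Rightarrow> real ^ 'n \<Rightarrow> complex" where
  "harmonic_Fock_projection \<alpha> f x =
     (\<integral>y. harmonic_Fock_kernel \<alpha> x y * f y \<partial>gauss_measure \<alpha>)"

definition Lp_functions :: "real \<Rightarrow> 'a measure \<Rightarrow> ('a \<Rightarrow> complex) set" where
  "Lp_functions p M = {f \<in> borel_measurable M. integrable M (\<lambda>x. norm (f x) powr p)}"

(* The Bochner integral of a non-integrable function is 0 by convention, so the existence of the
   defining integral at almost every point has to be required explicitly. *)
definition harmonic_Fock_projection_bounded ::
    "real \<Rightarrow> real \<Rightarrow> (real ^ 'n) measure \<Rightarrow> bool" where
  "harmonic_Fock_projection_bounded \<alpha> p M \<longleftrightarrow>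
     (\<forall>f\<in>Lp_functions p M.
        (AE x in M. integrable (gauss_measure \<alpha>) (\<lambda>y. harmonic_Fock_kernel \<alpha> x y * f y)) \<and>
        harmonic_Fock_projection \<alpha> f \<in> Lp_functions p M) \<and>
     (\<exists>C::real. \<forall>f\<in>Lp_functions p M.
        (\<integral>x. norm (harmonic_Fock_projection \<alpha> f x) powr p \<partial>M)
          \<le> C * (\<integral>x. norm (f x) powr p \<partial>M))"

end

theory Submission
  imports Defs "HOL-Probability.Distributions"
begin

text \<open>
  Boundedness is tested on the functions \<open>f y = exp (- t |y|\<^sup>2) l(y)\<^sup>m\<close>, where
  \<open>l(y) = y\<^sub>a + i y\<^sub>b\<close> for two distinct coordinates \<open>a\<close> and \<open>b\<close>, so that \<open>l\<^sup>m\<close> is a harmonic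
  polynomial, homogeneous of degree \<open>m\<close>. Since homogeneous harmonic polynomials of different
  degrees are orthogonal with respect to every centred Gaussian, only the term of degree \<open>m\<close> of
  the kernel contributes to the projection of \<open>f\<close>, and the projection is
  \<open>K (1 + \<alpha> t)\<^sup>-\<^sup>m l\<^sup>m\<close> with a constant \<open>K > 0\<close> independent of \<open>m\<close>
  (\<open>harmonic_Fock_projection_gaussian\<close>). By scaling, the \<open>p\<close>-th power of the norm of \<open>f\<close> is that of
  \<open>l\<^sup>m\<close> times \<open>(1 + p \<beta> t)\<close> to the power \<open>- (n + p m) / 2\<close>. Boundedness, with one constant for all
  \<open>m\<close>, therefore forces \<open>1 + p \<beta> t \<le> (1 + \<alpha> t)\<^sup>2\<close> for all \<open>t\<close> near \<open>0\<close>, of either sign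
  (\<open>bounded_imp_growth_le\<close>). Both sides agree at \<open>t = 0\<close>, so their derivatives there,
  \<open>p \<beta>\<close> and \<open>2 \<alpha>\<close>, are equal.

  The zonal harmonics enter through their reproducing property only. All inner products are taken
  against the weight \<open>exp (- |y|\<^sup>2)\<close> on the whole space, where integration by parts has no boundary
  terms: it gives the orthogonality of different degrees (\<open>homogeneous_harmonic_orthogonal\<close>) and a
  Gaussian mean value property (\<open>gauss_mean_value\<close>). The latter yields the bound
  \<open>homogeneous_harmonic_eval_bound\<close> for point evaluations, from which it follows that the space of
  each degree has a finite complete orthonormal family (\<open>orthonormal_harmonics_complete\<close>). On
  homogeneous functions of a fixed degree, the Gaussian and the spherical inner product differ by a
  constant factor (\<open>gauss_inner_sphere\<close>); hence the zonal harmonics exist and are given by that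
  family (\<open>zonal_harmonic_eq\<close>). The evaluation bound also makes the kernel series converge,
  dominated by an exponential function, so that it can be integrated term by term.
\<close>

section \<open>Complex-valued polynomial functions\<close>

lemma polynomial_function_complex_iff:
  fixes f :: "'a::euclidean_space \<Rightarrow> complex"
  shows "polynomial_function f \<longleftrightarrow>
    real_polynomial_function (\<lambda>x. Re (f x)) \<and> real_polynomial_function (\<lambda>x. Im (f x))"
  by (simp add: polynomial_function_iff_Basis_inner Basis_complex_def inner_complex_def)

lemma polynomial_function_of_real:
  fixes f :: "'a::euclidean_space \<Rightarrow> real"
  assumes "real_polynomial_function f"
  shows "polynomial_function (\<lambda>x. complex_of_real (f x))"
  using assms by (auto simp: polynomial_function_complex_iff)

lemma polynomial_function_cnj:
  fixes f :: "'a::euclidean_space \<Rightarrow> complex"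
  assumes "polynomial_function f"
  shows "polynomial_function (\<lambda>x. cnj (f x))"
  using assms by (auto simp: polynomial_function_complex_iff)

lemma polynomial_function_times:
  fixes f g :: "'a::euclidean_space \<Rightarrow> complex"
  assumes "polynomial_function f" "polynomial_function g"
  shows "polynomial_function (\<lambda>x. f x * g x)"
  using assms by (auto simp: polynomial_function_complex_iff)

lemma polynomial_function_power:
  fixes f :: "'a::euclidean_space \<Rightarrow> complex"
  assumes "polynomial_function f"
  shows "polynomial_function (\<lambda>x. f x ^ k)"
  by (induction k) (auto intro: polynomial_function_times assms)

lemma real_polynomial_function_inner:
  "real_polynomial_function (\<lambda>x::'a::euclidean_space. x \<bullet> e)"
  by (simp add: bounded_linear_inner_left real_polynomial_function.intros(1))

lemma real_polynomial_function_norm_square: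
  "real_polynomial_function (\<lambda>x::'a::euclidean_space. (norm x)\<^sup>2)"
proof -
  have "(\<lambda>x::'a. (norm x)\<^sup>2) = (\<lambda>x. \<Sum>b\<in>Basis. (x \<bullet> b) * (x \<bullet> b))"
    by (intro ext) (metis power2_norm_eq_inner euclidean_inner)
  moreover have "real_polynomial_function (\<lambda>x::'a. \<Sum>b\<in>Basis. (x \<bullet> b) * (x \<bullet> b))"
    by (intro real_polynomial_function_sum real_polynomial_function.intros(4)
        real_polynomial_function_inner finite_Basis)
  ultimately show ?thesis
    by simp
qed

lemma polynomial_function_shift:
  fixes f :: "'a::euclidean_space \<Rightarrow> 'b::euclidean_space"
  assumes "polynomial_function f"
  shows "polynomial_function (\<lambda>y. f (a + c *\<^sub>R y))"
proof -
  have "polynomial_function (\<lambda>y::'a. a + c *\<^sub>R y)"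
    by auto
  from polynomial_function_compose[OF this assms] show ?thesis
    by (simp add: o_def)
qed

lemma borel_measurable_polynomial_function:
  fixes f :: "'a::euclidean_space \<Rightarrow> 'b::euclidean_space"
  assumes "polynomial_function f"
  shows "f \<in> borel_measurable borel"
  using assms by (intro borel_measurable_continuous_onI continuous_on_polymonial_function)

lemma real_polynomial_function_has_derivative:
  fixes f :: "'a::euclidean_space \<Rightarrow> real"
  assumes "real_polynomial_function f"
  shows "\<exists>G. (\<forall>e. real_polynomial_function (\<lambda>x. G x e)) \<and> (\<forall>x. (f has_derivative G x) (at x))"
  using assms
proof induction
  case (linear f)
  then show ?case
    by (intro exI[of _ "\<lambda>x. f"]) (auto intro: bounded_linear_imp_has_derivative)
next
  case (const c)
  show ?case
    by (intro exI[of _ "\<lambda>x h. 0"]) auto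
next
  case (add f g)
  then obtain F G where "\<forall>e. real_polynomial_function (\<lambda>x. F x e)"
      "\<forall>x. (f has_derivative F x) (at x)" "\<forall>e. real_polynomial_function (\<lambda>x. G x e)"
      "\<forall>x. (g has_derivative G x) (at x)"
    by blast
  then show ?case
    by (intro exI[of _ "\<lambda>x h. F x h + G x h"]) (auto intro: has_derivative_add)
next
  case (mult f g)
  then obtain F G where "\<forall>e. real_polynomial_function (\<lambda>x. F x e)"
      "\<forall>x. (f has_derivative F x) (at x)" "\<forall>e. real_polynomial_function (\<lambda>x. G x e)"
      "\<forall>x. (g has_derivative G x) (at x)"
    by blast
  then show ?case using mult(1,2)
    by (intro exI[of _ "\<lambda>x h. f x * G x h + F x h * g x"] conjI allI has_derivative_mult
        real_polynomial_function.intros(3,4)) auto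
qed

text \<open>The values \<open>G x e\<close> of the derivative are kept as polynomials in the base point \<open>x\<close> for each
  fixed direction \<open>e\<close>; they turn out to be the partial derivatives.\<close>

lemma polynomial_function_has_derivative_ex:
  fixes f :: "'a::euclidean_space \<Rightarrow> complex"
  assumes "polynomial_function f"
  shows "\<exists>G. (\<forall>e. polynomial_function (\<lambda>x. G x e)) \<and> (\<forall>x. (f has_derivative G x) (at x))"
proof -
  have "real_polynomial_function (\<lambda>x. Re (f x))" "real_polynomial_function (\<lambda>x. Im (f x))"
    using assms by (auto simp: polynomial_function_complex_iff)
  then obtain F G where "\<forall>e. real_polynomial_function (\<lambda>x. F x e)"
      "\<forall>x. ((\<lambda>x. Re (f x)) has_derivative F x) (at x)"
      "\<forall>e. real_polynomial_function (\<lambda>x. G x e)"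
      "\<forall>x. ((\<lambda>x. Im (f x)) has_derivative G x) (at x)"
    by (metis real_polynomial_function_has_derivative)
  then show ?thesis
    by (intro exI[of _ "\<lambda>x h. Complex (F x h) (G x h)"])
       (auto simp: polynomial_function_complex_iff has_derivative_componentwise_within[of f]
          Basis_complex_def inner_complex_def)
qed

lemma partial_deriv_eqI:
  assumes "(f has_derivative G) (at x)"
  shows "partial_deriv e f x = G e"
proof -
  have 1: "((\<lambda>t. x + t *\<^sub>R e) has_derivative (\<lambda>t. t *\<^sub>R e)) (at (0::real))"
    by (auto intro!: derivative_eq_intros)
  have "((\<lambda>t. f (x + t *\<^sub>R e)) has_derivative (\<lambda>t. G (t *\<^sub>R e))) (at 0)"
    using diff_chain_at[OF 1, of f G] assms by (simp add: o_def)
  moreover have "G (t *\<^sub>R e) = t *\<^sub>R G e" for t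
    using assms has_derivative_linear linear_cmul by blast
  ultimately show ?thesis
    unfolding partial_deriv_def
    by (auto intro!: vector_derivative_at simp: has_vector_derivative_def)
qed

lemma polynomial_function_partial_deriv:
  assumes "polynomial_function f"
  shows "polynomial_function (partial_deriv e f)"
proof -
  obtain G where G: "\<forall>e. polynomial_function (\<lambda>x. G x e)" "\<forall>x. (f has_derivative G x) (at x)"
    using polynomial_function_has_derivative_ex[OF assms] by blast
  then have "partial_deriv e f = (\<lambda>x. G x e)"
    by (intro ext partial_deriv_eqI) auto
  with G show ?thesis by simp
qed

lemma polynomial_function_has_derivative:
  assumes "polynomial_function f"
  shows "(f has_derivative (\<lambda>h. partial_deriv h f x)) (at x)"
proof -
  obtain G where G: "\<forall>x. (f has_derivative G x) (at x)"
    using polynomial_function_has_derivative_ex[OF assms] by blast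
  then have "(\<lambda>h. partial_deriv h f x) = G x"
    by (intro ext partial_deriv_eqI) auto
  with G show ?thesis by simp
qed

lemma partial_deriv_direction:
  assumes "polynomial_function f"
  shows "partial_deriv h f x = (\<Sum>e\<in>Basis. (h \<bullet> e) *\<^sub>R partial_deriv e f x)"
proof -
  have "linear (\<lambda>h. partial_deriv h f x)"
    using polynomial_function_has_derivative[OF assms] has_derivative_linear by blast
  from linear_sum[OF this, of "\<lambda>e. (h \<bullet> e) *\<^sub>R e" Basis] show ?thesis
    by (simp add: euclidean_representation linear_cmul[OF \<open>linear _\<close>])
qed

lemma has_vector_derivative_along_line:
  assumes "polynomial_function f"
  shows "((\<lambda>s. f (x + s *\<^sub>R y)) has_vector_derivative partial_deriv y f (x + s *\<^sub>R y)) (at s)"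
proof -
  have 1: "((\<lambda>t. x + t *\<^sub>R y) has_derivative (\<lambda>t. t *\<^sub>R y)) (at s)"
    by (auto intro!: derivative_eq_intros)
  have "((\<lambda>t. f (x + t *\<^sub>R y)) has_derivative (\<lambda>t. partial_deriv (t *\<^sub>R y) f (x + s *\<^sub>R y))) (at s)"
    using diff_chain_at[OF 1 polynomial_function_has_derivative[OF assms]] by (simp add: o_def)
  moreover have "partial_deriv (t *\<^sub>R y) f z = t *\<^sub>R partial_deriv y f z" for t z
    using polynomial_function_has_derivative[OF assms] has_derivative_linear linear_cmul by blast
  ultimately show ?thesis
    by (simp add: has_vector_derivative_def)
qed

lemma partial_deriv_times:
  assumes "polynomial_function f" "polynomial_function g"
  shows "partial_deriv e (\<lambda>x. f x * g x) x =
    partial_deriv e f x * g x + f x * partial_deriv e g x"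
  by (rule trans, rule partial_deriv_eqI, rule has_derivative_mult)
     (auto intro: polynomial_function_has_derivative assms)

lemma partial_deriv_diff:
  assumes "polynomial_function f" "polynomial_function g"
  shows "partial_deriv e (\<lambda>x. f x - g x) x = partial_deriv e f x - partial_deriv e g x"
  by (rule trans, rule partial_deriv_eqI, rule has_derivative_diff)
     (auto intro: polynomial_function_has_derivative assms)

lemma partial_deriv_add:
  assumes "polynomial_function f" "polynomial_function g"
  shows "partial_deriv e (\<lambda>x. f x + g x) x = partial_deriv e f x + partial_deriv e g x"
  by (rule trans, rule partial_deriv_eqI, rule has_derivative_add)
     (auto intro: polynomial_function_has_derivative assms)

lemma partial_deriv_const: "partial_deriv e (\<lambda>x. c) x = 0"
  by (simp add: partial_deriv_def)

lemma partial_deriv_cmult: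
  assumes "polynomial_function f"
  shows "partial_deriv e (\<lambda>x. c * f x) x = c * partial_deriv e f x"
  using partial_deriv_times[OF _ assms, of "\<lambda>x. c"] by (simp add: partial_deriv_const)

lemma partial_deriv_cnj:
  assumes "polynomial_function f"
  shows "partial_deriv e (\<lambda>x. cnj (f x)) x = cnj (partial_deriv e f x)"
  by (rule trans, rule partial_deriv_eqI, rule has_derivative_cnj)
     (auto intro: polynomial_function_has_derivative assms)

lemma partial_deriv_inner:
  "partial_deriv e (\<lambda>x. complex_of_real (x \<bullet> b)) x = of_real (e \<bullet> b)"
  by (rule trans, rule partial_deriv_eqI) (auto intro!: derivative_eq_intros)

lemma partial_deriv_shift:
  assumes "polynomial_function f"
  shows "partial_deriv e (\<lambda>y. f (a + c *\<^sub>R y)) x = c *\<^sub>R partial_deriv e f (a + c *\<^sub>R x)"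
proof -
  have 1: "((\<lambda>y. a + c *\<^sub>R y) has_derivative (\<lambda>y. c *\<^sub>R y)) (at x)"
    by (auto intro!: derivative_eq_intros)
  have "((\<lambda>y. f (a + c *\<^sub>R y)) has_derivative (\<lambda>h. partial_deriv (c *\<^sub>R h) f (a + c *\<^sub>R x))) (at x)"
    using diff_chain_at[OF 1 polynomial_function_has_derivative[OF assms]] by (simp add: o_def)
  moreover have "partial_deriv (c *\<^sub>R h) f z = c *\<^sub>R partial_deriv h f z" for h z
    using polynomial_function_has_derivative[OF assms] has_derivative_linear linear_cmul by blast
  ultimately show ?thesis
    using partial_deriv_eqI by metis
qed

lemma Euler_homogeneous:
  assumes f: "polynomial_function f" and hom: "\<And>c x. f (c *\<^sub>R x) = of_real (c ^ k) * f x"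
  shows "partial_deriv x f x = of_nat k * f x"
proof -
  have "((\<lambda>s. f (x + s *\<^sub>R x)) has_vector_derivative partial_deriv x f (x + 0 *\<^sub>R x)) (at 0)"
    by (rule has_vector_derivative_along_line[OF f])
  moreover have "(\<lambda>s. f (x + s *\<^sub>R x)) = (\<lambda>s. of_real ((1 + s) ^ k) * f x)"
    by (metis (no_types) hom scaleR_left_distrib scaleR_one)
  moreover have "((\<lambda>s. of_real ((1 + s) ^ k) * f x) has_vector_derivative
      of_nat k * f x) (at 0)"
  proof -
    have "((\<lambda>s. (1 + s) ^ k) has_field_derivative real k) (at (0::real))"
      by (auto intro!: derivative_eq_intros)
    from has_vector_derivative_scaleR[OF this has_vector_derivative_const[of "f x"]]
    show ?thesis
      by (simp add: scaleR_conv_of_real)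
  qed
  ultimately show ?thesis
    by (metis add.right_neutral scaleR_zero_left vector_derivative_at)
qed

text \<open>Exponential bounds are a convenient substitute for the degree: they are stable under sums and
  products and are absorbed by every Gaussian.\<close>

lemma real_polynomial_function_exp_bound:
  fixes f :: "'a::euclidean_space \<Rightarrow> real"
  assumes "real_polynomial_function f"
  shows "\<exists>C\<ge>0. \<exists>a\<ge>0. \<forall>x. norm (f x) \<le> C * exp (a * norm x)"
  using assms
proof induction
  case (linear f)
  then obtain K where K: "0 < K" "\<And>x. norm (f x) \<le> norm x * K"
    using bounded_linear.pos_bounded by blast
  have "norm (f x) \<le> K * exp (1 * norm x)" for x
  proof -
    have "norm x \<le> exp (norm x)"
      using exp_ge_add_one_self[of "norm x"] by linarith
    then have "norm x * K \<le> exp (norm x) * K"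
      using K(1) by (intro mult_right_mono) auto
    then show ?thesis
      using K(2)[of x] by (simp add: mult.commute)
  qed
  then show ?case
    using K(1) by (intro exI[of _ K] conjI exI[of _ 1]) auto
next
  case (const c)
  show ?case
    by (intro exI[of _ "norm c"] conjI exI[of _ 0]) auto
next
  case (add f g)
  then obtain C a D b where "0 \<le> C" "0 \<le> a" and f: "\<forall>x. norm (f x) \<le> C * exp (a * norm x)"
    and "0 \<le> D" "0 \<le> b" and g: "\<forall>x. norm (g x) \<le> D * exp (b * norm x)"
    by blast
  have "norm (f x + g x) \<le> (C + D) * exp ((a + b) * norm x)" for x
  proof -
    have "norm (f x) \<le> C * exp ((a + b) * norm x)"
      by (rule order_trans[OF f[rule_format]])
         (use \<open>0 \<le> C\<close> \<open>0 \<le> b\<close> in \<open>auto intro!: mult_left_mono mult_right_mono\<close>)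
    moreover have "norm (g x) \<le> D * exp ((a + b) * norm x)"
      by (rule order_trans[OF g[rule_format]])
         (use \<open>0 \<le> D\<close> \<open>0 \<le> a\<close> in \<open>auto intro!: mult_left_mono mult_right_mono\<close>)
    ultimately show ?thesis
      using norm_triangle_ineq[of "f x" "g x"] by (simp add: distrib_right)
  qed
  then show ?case
    using \<open>0 \<le> C\<close> \<open>0 \<le> a\<close> \<open>0 \<le> D\<close> \<open>0 \<le> b\<close> by (intro exI[of _ "C+D"] conjI exI[of _ "a+b"]) auto
next
  case (mult f g)
  then obtain C a D b where "0 \<le> C" "0 \<le> a" and f: "\<forall>x. norm (f x) \<le> C * exp (a * norm x)"
    and "0 \<le> D" "0 \<le> b" and g: "\<forall>x. norm (g x) \<le> D * exp (b * norm x)"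
    by blast
  have "norm (f x * g x) \<le> (C * D) * exp ((a + b) * norm x)" for x
  proof -
    have "norm (f x * g x) \<le> (C * exp (a * norm x)) * (D * exp (b * norm x))"
      unfolding norm_mult using f g \<open>0 \<le> C\<close> by (intro mult_mono) auto
    also have "\<dots> = (C * D) * exp ((a + b) * norm x)"
      by (simp add: distrib_right exp_add)
    finally show ?thesis .
  qed
  then show ?case
    using \<open>0 \<le> C\<close> \<open>0 \<le> a\<close> \<open>0 \<le> D\<close> \<open>0 \<le> b\<close> by (intro exI[of _ "C*D"] conjI exI[of _ "a+b"]) auto
qed

lemma polynomial_function_exp_bound:
  fixes f :: "'a::euclidean_space \<Rightarrow> complex"
  assumes "polynomial_function f"
  obtains C a where "C \<ge> 0" "a \<ge> 0" "\<And>x. norm (f x) \<le> C * exp (a * norm x)"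
proof -
  have "real_polynomial_function (\<lambda>x. Re (f x) * Re (f x) + Im (f x) * Im (f x) + 1)"
    using assms unfolding polynomial_function_complex_iff
    by (intro real_polynomial_function.intros(2-4)) auto
  then obtain C a where C: "C \<ge> 0" "a \<ge> 0"
      "\<And>x. norm (Re (f x) * Re (f x) + Im (f x) * Im (f x) + 1) \<le> C * exp (a * norm x)"
    using real_polynomial_function_exp_bound by blast
  have "norm (f x) \<le> C * exp (a * norm x)" for x
  proof -
    have "norm (f x) \<le> (norm (f x))\<^sup>2 + 1"
      using sum_squares_bound[of "norm (f x)" 1] by simp (smt (verit) norm_ge_zero zero_le_power2)
    also have "\<dots> \<le> norm (Re (f x) * Re (f x) + Im (f x) * Im (f x) + 1)"
      unfolding cmod_power2 by (simp add: power2_eq_square)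
    finally show ?thesis using C(3)[of x] by linarith
  qed
  with C that show ?thesis by blast
qed

section \<open>Gaussian integrals\<close>

text \<open>By Tonelli's theorem, the integral of \<open>exp (- |x|)\<close> is that of \<open>exp (- r)\<close> times the volume of
  the ball of radius \<open>r\<close>.\<close>

lemma integrable_exp_neg_norm:
  "integrable lborel (\<lambda>x::'a::euclidean_space. exp (- norm x))"
proof (rule integrableI_bounded)
  show "(\<lambda>x::'a. exp (- norm x)) \<in> borel_measurable lborel"
    by measurable
  have tail: "ennreal (exp (- norm x)) =
      (\<integral>\<^sup>+r. ennreal (exp (- r)) * indicator {norm x..} r \<partial>lborel)" for x :: 'a
  proof -
    have "((\<lambda>r::real. - exp (- r)) \<longlongrightarrow> -(0::real)) at_top"
      by (intro tendsto_minus filterlim_compose[OF exp_at_bot]) (rule filterlim_uminus_at_bot_at_top)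
    then have "(\<integral>\<^sup>+r. ennreal (exp (- r)) * indicator {norm x..} r \<partial>lborel)
        = ennreal (0 - (- exp (- norm x)))"
      by (intro nn_integral_FTC_atLeast[where F="\<lambda>r. - exp (- r)"])
         (auto intro!: derivative_eq_intros)
    then show ?thesis by simp
  qed
  define v where "v = measure lborel (cball (0::'a) 1)"
  have "(\<integral>\<^sup>+x. ennreal (norm (exp (- norm (x::'a)))) \<partial>lborel) =
      (\<integral>\<^sup>+x. (\<integral>\<^sup>+r. ennreal (exp (- r)) * indicator {norm (x::'a)..} r \<partial>lborel) \<partial>lborel)"
    by (simp add: tail)
  also have "\<dots> = (\<integral>\<^sup>+r. (\<integral>\<^sup>+x. ennreal (exp (- r)) * indicator {norm (x::'a)..} r \<partial>lborel) \<partial>lborel)"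
  proof (rule lborel_pair.Fubini')
    have "(\<lambda>p::real \<times> 'a. ennreal (exp (- fst p)) * indicator {p. norm (snd p) \<le> fst p} p)
        \<in> borel_measurable (lborel \<Otimes>\<^sub>M lborel)"
      by measurable
    moreover have "(\<lambda>p::real \<times> 'a. ennreal (exp (- fst p)) * indicator {p. norm (snd p) \<le> fst p} p)
        = (\<lambda>(r, x). ennreal (exp (- r)) * indicator {norm x..} r)"
      by (auto simp: indicator_def fun_eq_iff)
    ultimately show "(\<lambda>(r, x::'a). ennreal (exp (- r)) * indicator {norm x..} r)
        \<in> borel_measurable (lborel \<Otimes>\<^sub>M lborel)"
      by simp
  qed
  also have "\<dots> = (\<integral>\<^sup>+r. ennreal (unit_ball_vol (real DIM('a))) *
      (ennreal (r ^ DIM('a) * exp (- r)) * indicator {0..} r) \<partial>lborel)"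
  proof (rule nn_integral_cong)
    fix r :: real
    have "(\<integral>\<^sup>+x. ennreal (exp (- r)) * indicator {norm (x::'a)..} r \<partial>lborel) =
        (\<integral>\<^sup>+x. ennreal (exp (- r)) * indicator (cball (0::'a) r) x \<partial>lborel)"
      by (rule nn_integral_cong) (auto simp: indicator_def)
    also have "\<dots> = ennreal (exp (- r)) * emeasure lborel (cball (0::'a) r)"
      by (subst nn_integral_cmult_indicator) auto
    also have "\<dots> = ennreal (unit_ball_vol (real DIM('a))) *
        (ennreal (r ^ DIM('a) * exp (- r)) * indicator {0..} r)"
    proof (cases "r \<ge> 0")
      case True
      then show ?thesis
        by (simp add: emeasure_cball ennreal_mult[symmetric] mult_ac)
    qed simp
    finally show "(\<integral>\<^sup>+x. ennreal (exp (- r)) * indicator {norm (x::'a)..} r \<partial>lborel) = \<dots>" .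
  qed
  also have "\<dots> = ennreal (unit_ball_vol (real DIM('a))) * real_of_nat (fact DIM('a))"
    by (subst nn_integral_cmult) (auto simp: nn_intergal_power_times_exp_Ici)
  also have "\<dots> < \<infinity>"
    by (auto simp: ennreal_mult_less_top)
  finally show "(\<integral>\<^sup>+x. ennreal (norm (exp (- norm (x::'a)))) \<partial>lborel) < \<infinity>" .
qed

lemma exp_linear_minus_square_le:
  fixes s a r :: real
  assumes "s > 0"
  shows "exp (- (s * r\<^sup>2)) * exp (a * r) \<le> exp ((a + 1)\<^sup>2 / (4 * s)) * exp (- r)"
proof -
  \<comment> \<open>completing the square in \<open>s r\<^sup>2 - (a + 1) r\<close>\<close>
  have "0 \<le> (2 * s * r - (a + 1))\<^sup>2 / (4 * s)"
    using assms by simp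
  also have "\<dots> = s * r\<^sup>2 - (a + 1) * r + (a + 1)\<^sup>2 / (4 * s)"
    using assms by (simp add: power2_eq_square field_simps)
  finally show ?thesis
    by (simp add: exp_add[symmetric] algebra_simps)
qed

lemma integrable_gauss:
  fixes f :: "'a::euclidean_space \<Rightarrow> 'b::{banach, second_countable_topology}"
  assumes "f \<in> borel_measurable borel" and "\<And>x. norm (f x) \<le> C * exp (a * norm x)"
    and "s > 0"
  shows "integrable lborel (\<lambda>x. exp (- (s * (norm x)\<^sup>2)) *\<^sub>R f x)"
proof -
  let ?K = "exp ((a + 1)\<^sup>2 / (4 * s))"
  have "integrable lborel (\<lambda>x::'a. C * ?K * exp (- norm x))"
    by (intro integrable_mult_right integrable_exp_neg_norm)
  then show ?thesis
  proof (rule Bochner_Integration.integrable_bound)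
    show "(\<lambda>x. exp (- (s * (norm x)\<^sup>2)) *\<^sub>R f x) \<in> borel_measurable lborel"
      using assms(1) by simp
    have "norm (exp (- (s * (norm x)\<^sup>2)) *\<^sub>R f x) \<le> norm (C * ?K * exp (- norm x))" for x
    proof -
      have "0 \<le> C"
        using order_trans[OF norm_ge_zero assms(2)[of x]] by (simp add: zero_le_mult_iff)
      have "norm (exp (- (s * (norm x)\<^sup>2)) *\<^sub>R f x) \<le>
          exp (- (s * (norm x)\<^sup>2)) * (C * exp (a * norm x))"
        using assms(2)[of x] by (auto intro!: mult_left_mono)
      also have "\<dots> = C * (exp (- (s * (norm x)\<^sup>2)) * exp (a * norm x))"
        by simp
      also have "\<dots> \<le> C * (?K * exp (- norm x))"
        by (intro mult_left_mono exp_linear_minus_square_le \<open>s > 0\<close> \<open>0 \<le> C\<close>)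
      also have "\<dots> \<le> norm (C * ?K * exp (- norm x))"
        by simp
      finally show ?thesis .
    qed
    then show "AE x in lborel. norm (exp (- (s * (norm x)\<^sup>2)) *\<^sub>R f x) \<le> norm (C * ?K * exp (- norm x))"
      by simp
  qed
qed

lemma integrable_gauss_polynomial:
  fixes f :: "'a::euclidean_space \<Rightarrow> complex"
  assumes "polynomial_function f" "s > 0"
  shows "integrable lborel (\<lambda>x. exp (- (s * (norm x)\<^sup>2)) *\<^sub>R f x)"
proof -
  obtain C a where "\<And>x. norm (f x) \<le> C * exp (a * norm x)"
    using polynomial_function_exp_bound[OF assms(1)] by blast
  then show ?thesis
    by (rule integrable_gauss[OF borel_measurable_polynomial_function[OF assms(1)]]) fact
qed

lemma integral_lborel_scale:
  fixes f :: "'a::euclidean_space \<Rightarrow> 'b::{banach, second_countable_topology}"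
  assumes [measurable]: "f \<in> borel_measurable borel" and r: "r > 0"
  shows "(\<integral>x. f x \<partial>lborel) = r ^ DIM('a) *\<^sub>R (\<integral>x. f (r *\<^sub>R x) \<partial>lborel)"
proof -
  have *: "lborel = density (distr lborel borel (\<lambda>x::'a. r *\<^sub>R x)) (\<lambda>_. ennreal (r ^ DIM('a)))"
    using lborel_affine[of r "0::'a"] r by simp
  show ?thesis
    using r by (subst *) (simp add: integral_density integral_distr)
qed

lemma
  fixes f :: "'a::euclidean_space \<Rightarrow> 'b::{banach, second_countable_topology}"
  assumes [measurable]: "f \<in> borel_measurable borel"
  shows integral_lborel_translate: "(\<integral>x. f (x + a) \<partial>lborel) = (\<integral>x. f x \<partial>lborel)"
    and integrable_lborel_translate: "integrable lborel (\<lambda>x. f (x + a)) \<longleftrightarrow> integrable lborel f"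
proof -
  have *: "lborel = distr lborel borel (\<lambda>x. x + a)"
  proof -
    have "(+) a = (\<lambda>x. x + a)"
      by (auto simp: add.commute)
    then show ?thesis
      using lborel_distr_plus[of a] by simp
  qed
  show "(\<integral>x. f (x + a) \<partial>lborel) = (\<integral>x. f x \<partial>lborel)"
    by (subst (2) *) (simp add: integral_distr)
  have "integrable lborel f \<longleftrightarrow> integrable (distr lborel borel (\<lambda>x. x + a)) f"
    by (simp add: *[symmetric])
  then show "integrable lborel (\<lambda>x. f (x + a)) \<longleftrightarrow> integrable lborel f"
    by (simp add: integrable_distr_eq)
qed

lemma integral_lborel_pos:
  fixes g :: "'a::euclidean_space \<Rightarrow> real"
  assumes int: "integrable lborel g" and cont: "continuous_on UNIV g"
    and nn: "\<And>x. g x \<ge> 0" and x0: "g x0 > 0"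
  shows "(\<integral>x. g x \<partial>lborel) > 0"
proof (rule ccontr)
  assume "\<not> (\<integral>x. g x \<partial>lborel) > 0"
  moreover have "(\<integral>x. g x \<partial>lborel) \<ge> 0"
    by (simp add: nn)
  ultimately have "(\<integral>x. g x \<partial>lborel) = 0" by simp
  then have "AE x in lborel. g x = 0"
    using integral_nonneg_eq_0_iff_AE[OF int] nn by simp
  then have "AE x in lebesgue. \<not> g x > 0"
    by (auto intro: AE_mp[OF AE_completion])
  then have "negligible {x. g x > 0}"
    by (simp add: negligible_iff_null_sets AE_iff_null_sets[symmetric] eventually_ae_filter)
       (metis (no_types, lifting) completion.complete2 mem_Collect_eq subsetI subsetD)
  moreover have "open {x. g x > 0}"
    using cont by (intro open_Collect_less) (auto intro: continuous_intros)
  ultimately show False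
    using open_not_negligible x0 by blast
qed

text \<open>The fundamental theorem of calculus in a parameter, integrated over the space by Fubini's
  theorem. It replaces differentiation under the integral sign, both for integration by parts
  (translating the argument) and for the mean value property (dilating it).\<close>

lemma integral_difference_of_derivative:
  fixes \<Phi> \<Phi>' :: "real \<Rightarrow> 'a::euclidean_space \<Rightarrow> complex"
  assumes deriv: "\<And>s y. ((\<lambda>s. \<Phi> s y) has_vector_derivative \<Phi>' s y) (at s)"
    and cont: "continuous_on UNIV (\<lambda>(s, y). \<Phi>' s y)"
    and bound: "\<And>s y. 0 \<le> s \<Longrightarrow> s \<le> 1 \<Longrightarrow> norm (\<Phi>' s y) \<le> w y"
    and w: "integrable lborel w"
    and L: "\<And>s. 0 \<le> s \<Longrightarrow> s \<le> 1 \<Longrightarrow> (\<integral>y. \<Phi>' s y \<partial>lborel) = L"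
  shows "(\<integral>y. \<Phi> 1 y - \<Phi> 0 y \<partial>lborel) = L"
proof -
  define g where "g = (\<lambda>s y. indicator {0..1::real} s *\<^sub>R \<Phi>' s y)"
  have "(\<lambda>(s, y). \<Phi>' s y) \<in> borel_measurable borel"
    using cont by (rule borel_measurable_continuous_onI)
  then have [measurable]: "(\<lambda>(s, y). \<Phi>' s y) \<in> borel_measurable (lborel \<Otimes>\<^sub>M lborel)"
    by (simp add: borel_prod[symmetric] cong: measurable_cong_sets)
  have [measurable]: "w \<in> borel_measurable lborel"
    using w by auto
  have "integrable (lborel \<Otimes>\<^sub>M lborel) (\<lambda>(s, y). indicator {0..1::real} s * w y)"
  proof (rule lborel_pair.Fubini_integrable)
    have "integrable lborel (\<lambda>s. indicator {0..1::real} s *\<^sub>R (\<integral>y. norm (w y) \<partial>lborel))"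
      by (rule integrable_scaleR_left) (auto intro: integrable_real_indicator)
    then show "integrable lborel (\<lambda>s. \<integral>y. norm (case (s, y) of (s, y) \<Rightarrow>
        indicator {0..1::real} s * w y) \<partial>lborel)"
      by (simp add: abs_mult)
  qed (use w in auto)
  then have "integrable (lborel \<Otimes>\<^sub>M lborel) (\<lambda>(s, y). g s y)"
  proof (rule Bochner_Integration.integrable_bound)
    show "(\<lambda>(s, y). g s y) \<in> borel_measurable (lborel \<Otimes>\<^sub>M lborel)"
      unfolding g_def by measurable
    have "norm (g s y) \<le> norm (indicator {0..1::real} s * w y)" for s y
      using bound[of s y] by (auto simp: g_def indicator_def)
    then show "AE x in lborel \<Otimes>\<^sub>M lborel. norm (case x of (s, y) \<Rightarrow> g s y)
        \<le> norm (case x of (s, y) \<Rightarrow> indicator {0..1::real} s * w y)"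
      by auto
  qed
  from lborel_pair.Fubini_integral[OF this]
  have *: "(\<integral>y. (\<integral>s. g s y \<partial>lborel) \<partial>lborel) = (\<integral>s. (\<integral>y. g s y \<partial>lborel) \<partial>lborel)" .
  have "(\<integral>s. g s y \<partial>lborel) = \<Phi> 1 y - \<Phi> 0 y" for y
    unfolding g_def
  proof (rule integral_FTC_atLeastAtMost)
    show "continuous_on {0..1} (\<lambda>s. \<Phi>' s y)"
      by (rule continuous_on_compose2[OF cont, of _ "\<lambda>s. (s, y)", simplified])
         (auto intro: continuous_intros)
  qed (auto intro: has_vector_derivative_at_within deriv)
  moreover have "(\<integral>y. g s y \<partial>lborel) = indicator {0..1::real} s *\<^sub>R L" for s
    using L[of s] by (cases "0 \<le> s \<and> s \<le> 1") (auto simp: g_def)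
  moreover have "(\<integral>s. indicator {0..1::real} s *\<^sub>R L \<partial>lborel) = L"
    by (subst integral_scaleR_left) auto
  ultimately show ?thesis
    using * by simp
qed

text \<open>The integral against the unnormalized weight \<open>exp (- |y|\<^sup>2)\<close>. Its total mass
  \<open>gauss_moment TYPE('n) 0\<close>, defined below, need not be evaluated: only its positivity matters.\<close>

definition gauss_integral :: "(real ^ 'n \<Rightarrow> complex) \<Rightarrow> complex" where
  "gauss_integral f = (\<integral>y. exp (- (norm y)\<^sup>2) *\<^sub>R f y \<partial>lborel)"

lemma integrable_gauss_integral:
  fixes f :: "real ^ 'n \<Rightarrow> complex"
  assumes "polynomial_function f"
  shows "integrable lborel (\<lambda>y. exp (- (norm y)\<^sup>2) *\<^sub>R f y)"
  using integrable_gauss_polynomial[OF assms, of 1] by simp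

lemma gauss_integral_diff:
  assumes "polynomial_function f" "polynomial_function g"
  shows "gauss_integral (\<lambda>y. f y - g y) = gauss_integral f - gauss_integral g"
  using integrable_gauss_integral[OF assms(1)] integrable_gauss_integral[OF assms(2)]
  by (simp add: gauss_integral_def scaleR_diff_right)

lemma gauss_integral_sum:
  assumes "\<And>i. i \<in> I \<Longrightarrow> polynomial_function (f i)"
  shows "gauss_integral (\<lambda>y. \<Sum>i\<in>I. f i y) = (\<Sum>i\<in>I. gauss_integral (f i))"
  using integrable_gauss_integral[OF assms]
  by (simp add: gauss_integral_def scaleR_sum_right)

lemma gauss_integral_cmult: "gauss_integral (\<lambda>y. c * f y) = c * gauss_integral f"
  by (simp add: gauss_integral_def mult_scaleR_right[symmetric] del: mult_scaleR_right)

lemma gauss_integral_cnj: "gauss_integral (\<lambda>y. cnj (f y)) = cnj (gauss_integral f)"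
proof -
  have "gauss_integral (\<lambda>y. cnj (f y)) = (\<integral>y. cnj (exp (- (norm y)\<^sup>2) *\<^sub>R f y) \<partial>lborel)"
    by (simp add: gauss_integral_def complex_cnj_scaleR)
  then show ?thesis
    unfolding gauss_integral_def by (simp only: Bochner_Integration.integral_cnj)
qed

lemma gauss_integral_of_real:
  "gauss_integral (\<lambda>y. complex_of_real (f y)) = of_real (\<integral>y. exp (- (norm y)\<^sup>2) * f y \<partial>lborel)"
  by (simp add: gauss_integral_def scaleR_conv_of_real flip: of_real_mult)

text \<open>Integration by parts: the function \<open>h\<close> in the proof is the factor of the weight in the partial
  derivative of the product of \<open>f\<close> and the weight, and the integral of that derivative vanishes by
  translation invariance.\<close>

lemma gauss_integral_partial_deriv:
  fixes f :: "real ^ 'n \<Rightarrow> complex"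
  assumes f: "polynomial_function f"
  shows "gauss_integral (partial_deriv e f) = 2 * gauss_integral (\<lambda>y. of_real (y \<bullet> e) * f y)"
proof -
  define h where "h = (\<lambda>y. partial_deriv e f y - 2 * (of_real (y \<bullet> e) * f y))"
  have pe: "polynomial_function (\<lambda>y. of_real (y \<bullet> e) * f y)"
    by (intro polynomial_function_times polynomial_function_of_real real_polynomial_function_inner f)
  have h: "polynomial_function h"
    unfolding h_def by (intro polynomial_function_diff polynomial_function_partial_deriv f
        polynomial_function_times[OF _ pe]) auto
  obtain C a where C: "C \<ge> 0" "a \<ge> 0" "\<And>x. norm (h x) \<le> C * exp (a * norm x)"
    using polynomial_function_exp_bound[OF h] by blast
  have hm [measurable]: "h \<in> borel_measurable borel" "f \<in> borel_measurable borel"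
    using borel_measurable_polynomial_function h f by auto
  define \<Phi> where "\<Phi> = (\<lambda>s y. exp (- (norm (y + s *\<^sub>R e))\<^sup>2) *\<^sub>R f (y + s *\<^sub>R e))"
  define \<Phi>' where "\<Phi>' = (\<lambda>s y. exp (- (norm (y + s *\<^sub>R e))\<^sup>2) *\<^sub>R h (y + s *\<^sub>R e))"
  have "(\<integral>y. \<Phi> 1 y - \<Phi> 0 y \<partial>lborel) = gauss_integral h"
  proof (rule integral_difference_of_derivative)
    fix s y
    have "((\<lambda>s. exp (- ((y + s *\<^sub>R e) \<bullet> (y + s *\<^sub>R e)))) has_field_derivative
        exp (- ((y + s *\<^sub>R e) \<bullet> (y + s *\<^sub>R e))) * (- 2 * ((y + s *\<^sub>R e) \<bullet> e))) (at s)"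
      by (auto intro!: derivative_eq_intros simp: has_real_derivative_iff_has_vector_derivative
           has_vector_derivative_def inner_commute algebra_simps)
    from has_vector_derivative_scaleR[OF this has_vector_derivative_along_line[OF f]]
    show "((\<lambda>s. \<Phi> s y) has_vector_derivative \<Phi>' s y) (at s)"
      unfolding \<Phi>_def \<Phi>'_def h_def power2_norm_eq_inner
      by (simp add: algebra_simps scaleR_conv_of_real)
  next
    have "continuous_on UNIV h"
      by (intro continuous_on_polymonial_function h)
    then have "continuous_on UNIV (\<lambda>p. h (snd p + fst p *\<^sub>R e))"
      by (rule continuous_on_compose2) (auto intro!: continuous_intros)
    then show "continuous_on UNIV (\<lambda>(s, y). \<Phi>' s y)"
      unfolding \<Phi>'_def case_prod_unfold by (auto intro!: continuous_intros)
  next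
    let ?K = "exp ((a + 1)\<^sup>2 / 4)"
    fix s :: real and y :: "real ^ 'n" assume s: "0 \<le> s" "s \<le> 1"
    let ?z = "y + s *\<^sub>R e"
    have "norm (\<Phi>' s y) \<le> exp (- (norm ?z)\<^sup>2) * (C * exp (a * norm ?z))"
      using C(3) by (simp add: \<Phi>'_def)
    also have "\<dots> = C * (exp (- (1 * (norm ?z)\<^sup>2)) * exp (a * norm ?z))"
      by simp
    also have "\<dots> \<le> C * (?K * exp (- norm ?z))"
      using exp_linear_minus_square_le[of 1 "norm ?z" a] C by (intro mult_left_mono) auto
    also have "\<dots> \<le> C * (?K * (exp (norm e) * exp (- norm y)))"
    proof -
      have "norm y \<le> norm ?z + norm (s *\<^sub>R e)"
        by (metis add_diff_cancel_right' norm_triangle_ineq4)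
      also have "norm (s *\<^sub>R e) \<le> norm e"
        using s by (simp add: mult_left_le_one_le)
      finally show ?thesis
        using C by (intro mult_left_mono) (auto simp flip: exp_add)
    qed
    finally show "norm (\<Phi>' s y) \<le> C * (?K * (exp (norm e) * exp (- norm y)))" .
  next
    show "integrable lborel (\<lambda>y. C * (exp ((a + 1)\<^sup>2 / 4) * (exp (norm e) * exp (- norm y))))"
      by (intro integrable_mult_right integrable_exp_neg_norm)
  next
    fix s
    show "(\<integral>y. \<Phi>' s y \<partial>lborel) = gauss_integral h"
      unfolding \<Phi>'_def gauss_integral_def
      by (rule integral_lborel_translate[where f="\<lambda>z. exp (- (norm z)\<^sup>2) *\<^sub>R h z"]) measurable
  qed
  moreover have "(\<integral>y. \<Phi> 1 y - \<Phi> 0 y \<partial>lborel) = 0"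
  proof -
    let ?G = "\<lambda>z. exp (- (norm z)\<^sup>2) *\<^sub>R f z"
    have int: "integrable lborel ?G"
      by (rule integrable_gauss_integral[OF f])
    have "?G \<in> borel_measurable borel" by measurable
    note tr = integral_lborel_translate[OF this, of e] integrable_lborel_translate[OF this, of e]
    show ?thesis
      using tr int by (simp add: \<Phi>_def)
  qed
  ultimately have "gauss_integral h = 0" by simp
  moreover have "gauss_integral h =
      gauss_integral (partial_deriv e f) - 2 * gauss_integral (\<lambda>y. of_real (y \<bullet> e) * f y)"
    unfolding h_def gauss_integral_cmult[symmetric]
    by (intro gauss_integral_diff polynomial_function_partial_deriv f
        polynomial_function_times[OF _ pe]) auto
  ultimately show ?thesis by simp
qed

section \<open>Harmonic polynomials in the Gaussian inner product\<close>

lemma homogeneous_harmonic_polynomialsD: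
  assumes "p \<in> homogeneous_harmonic_polynomials k"
  shows "polynomial_function p" "p (c *\<^sub>R x) = of_real (c ^ k) * p x" "laplacian p x = 0"
  using assms by (auto simp: homogeneous_harmonic_polynomials_def)

lemma laplacian_add:
  assumes "polynomial_function f" "polynomial_function g"
  shows "laplacian (\<lambda>x. f x + g x) x = laplacian f x + laplacian g x"
proof -
  have "partial_deriv e (\<lambda>x. f x + g x) = (\<lambda>x. partial_deriv e f x + partial_deriv e g x)" for e
    by (intro ext partial_deriv_add assms)
  then show ?thesis
    by (simp add: laplacian_def sum.distrib partial_deriv_add polynomial_function_partial_deriv assms)
qed

lemma laplacian_cmult:
  assumes "polynomial_function f"
  shows "laplacian (\<lambda>x. c * f x) x = c * laplacian f x"
proof -
  have "partial_deriv e (\<lambda>x. c * f x) = (\<lambda>x. c * partial_deriv e f x)" for e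
    by (intro ext partial_deriv_cmult assms)
  then show ?thesis
    by (simp add: laplacian_def sum_distrib_left partial_deriv_cmult
        polynomial_function_partial_deriv assms)
qed

lemma laplacian_cnj:
  assumes "polynomial_function f"
  shows "laplacian (\<lambda>x. cnj (f x)) x = cnj (laplacian f x)"
proof -
  have "partial_deriv e (\<lambda>x. cnj (f x)) = (\<lambda>x. cnj (partial_deriv e f x))" for e
    by (intro ext partial_deriv_cnj assms)
  then show ?thesis
    by (simp add: laplacian_def partial_deriv_cnj polynomial_function_partial_deriv assms)
qed

lemma homogeneous_harmonic_polynomials_add:
  assumes "p \<in> homogeneous_harmonic_polynomials k" "q \<in> homogeneous_harmonic_polynomials k"
  shows "(\<lambda>x. p x + q x) \<in> homogeneous_harmonic_polynomials k"
  using assms unfolding homogeneous_harmonic_polynomials_def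
  by (auto simp: laplacian_add distrib_left)

lemma homogeneous_harmonic_polynomials_cmult:
  assumes "p \<in> homogeneous_harmonic_polynomials k"
  shows "(\<lambda>x. c * p x) \<in> homogeneous_harmonic_polynomials k"
  using assms unfolding homogeneous_harmonic_polynomials_def
  by (auto simp: laplacian_cmult intro: polynomial_function_times)

lemma homogeneous_harmonic_polynomials_cnj:
  assumes "p \<in> homogeneous_harmonic_polynomials k"
  shows "(\<lambda>x. cnj (p x)) \<in> homogeneous_harmonic_polynomials k"
  using assms unfolding homogeneous_harmonic_polynomials_def
  by (auto simp: laplacian_cnj intro: polynomial_function_cnj)

lemma homogeneous_harmonic_polynomials_zero:
  "(\<lambda>x. 0) \<in> homogeneous_harmonic_polynomials k"
  by (simp add: homogeneous_harmonic_polynomials_def laplacian_def partial_deriv_def)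

lemma homogeneous_harmonic_polynomials_diff:
  assumes "p \<in> homogeneous_harmonic_polynomials k" "q \<in> homogeneous_harmonic_polynomials k"
  shows "(\<lambda>x. p x - q x) \<in> homogeneous_harmonic_polynomials k"
  using homogeneous_harmonic_polynomials_add[OF assms(1)
      homogeneous_harmonic_polynomials_cmult[OF assms(2), of "-1"]]
  by simp

lemma homogeneous_harmonic_polynomials_sum:
  assumes "finite I" "\<And>i. i \<in> I \<Longrightarrow> p i \<in> homogeneous_harmonic_polynomials k"
  shows "(\<lambda>x. \<Sum>i\<in>I. p i x) \<in> homogeneous_harmonic_polynomials k"
  using assms
  by (induction I rule: finite_induct)
     (auto intro: homogeneous_harmonic_polynomials_zero homogeneous_harmonic_polynomials_add)

lemma gauss_integral_divergence:
  fixes V :: "real ^ 'n \<Rightarrow> real ^ 'n \<Rightarrow> complex"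
  assumes V: "\<And>e. e \<in> Basis \<Longrightarrow> polynomial_function (V e)"
  shows "gauss_integral (\<lambda>y. \<Sum>e\<in>Basis. partial_deriv e (V e) y) =
    2 * gauss_integral (\<lambda>y. \<Sum>e\<in>Basis. of_real (y \<bullet> e) * V e y)"
proof -
  have "gauss_integral (\<lambda>y. \<Sum>e\<in>Basis. partial_deriv e (V e) y) =
      (\<Sum>e\<in>Basis. gauss_integral (partial_deriv e (V e)))"
    by (intro gauss_integral_sum polynomial_function_partial_deriv V)
  also have "\<dots> = (\<Sum>e\<in>Basis. 2 * gauss_integral (\<lambda>y. of_real (y \<bullet> e) * V e y))"
    by (intro sum.cong refl gauss_integral_partial_deriv V)
  also have "\<dots> = 2 * gauss_integral (\<lambda>y. \<Sum>e\<in>Basis. of_real (y \<bullet> e) * V e y)"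
    by (subst gauss_integral_sum)
       (auto intro!: polynomial_function_times polynomial_function_of_real
          real_polynomial_function_inner V simp: sum_distrib_left)
  finally show ?thesis .
qed

text \<open>Green's identity: the Gaussian weight turns the boundary terms into radial derivatives,
  which Euler's identity evaluates.\<close>

lemma homogeneous_harmonic_orthogonal:
  fixes p q :: "real ^ 'n \<Rightarrow> complex"
  assumes p: "p \<in> homogeneous_harmonic_polynomials k"
    and q: "q \<in> homogeneous_harmonic_polynomials m" and "k \<noteq> m"
  shows "gauss_integral (\<lambda>y. p y * cnj (q y)) = 0"
proof -
  define r where "r = (\<lambda>y. cnj (q y))"
  have r: "r \<in> homogeneous_harmonic_polynomials m"
    unfolding r_def by (rule homogeneous_harmonic_polynomials_cnj[OF q])
  note P = homogeneous_harmonic_polynomialsD[OF p] homogeneous_harmonic_polynomialsD[OF r]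
  note poly = P(1,4) polynomial_function_partial_deriv polynomial_function_times
    polynomial_function_diff
  define V where "V = (\<lambda>e y. r y * partial_deriv e p y - p y * partial_deriv e r y)"
  have div: "partial_deriv e (V e) y =
      r y * partial_deriv e (partial_deriv e p) y - p y * partial_deriv e (partial_deriv e r) y" for e y
    unfolding V_def
    by (simp add: partial_deriv_diff partial_deriv_times poly algebra_simps)
  have "(\<Sum>e\<in>Basis. partial_deriv e (V e) y) = r y * laplacian p y - p y * laplacian r y" for y
    by (simp add: div laplacian_def sum_subtractf sum_distrib_left)
  then have "(\<lambda>y. \<Sum>e\<in>Basis. partial_deriv e (V e) y) = (\<lambda>y. 0)"
    by (simp add: P)
  then have "0 = gauss_integral (\<lambda>y. \<Sum>e\<in>Basis. partial_deriv e (V e) y)"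
    by (simp add: gauss_integral_def)
  also have "\<dots> = 2 * gauss_integral (\<lambda>y. \<Sum>e\<in>Basis. of_real (y \<bullet> e) * V e y)"
    unfolding V_def by (intro gauss_integral_divergence polynomial_function_diff
        polynomial_function_times polynomial_function_partial_deriv P(1,4))
  also have "(\<lambda>y. \<Sum>e\<in>Basis. of_real (y \<bullet> e) * V e y) =
      (\<lambda>y. (of_nat k - of_nat m) * (p y * r y))"
  proof
    fix y :: "real ^ 'n"
    have "(\<Sum>e\<in>Basis. of_real (y \<bullet> e) * V e y) =
        r y * partial_deriv y p y - p y * partial_deriv y r y"
      by (simp add: V_def partial_deriv_direction[OF P(1), of y] partial_deriv_direction[OF P(4), of y]
          sum_distrib_left sum_subtractf[symmetric] scaleR_conv_of_real algebra_simps)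
    also have "\<dots> = (of_nat k - of_nat m) * (p y * r y)"
      by (simp add: Euler_homogeneous[OF P(1,2)] Euler_homogeneous[OF P(4,5)] algebra_simps)
    finally show "(\<Sum>e\<in>Basis. of_real (y \<bullet> e) * V e y) = (of_nat k - of_nat m) * (p y * r y)" .
  qed
  finally show ?thesis
    using \<open>k \<noteq> m\<close> by (simp add: gauss_integral_cmult r_def)
qed

text \<open>The radial moment of order \<open>2 m\<close> of the weight. The first argument only fixes the dimension
  of the space.\<close>

definition gauss_moment :: "'n::finite itself \<Rightarrow> nat \<Rightarrow> real" where
  "gauss_moment _ m = (\<integral>y. exp (- (norm (y :: real ^ 'n))\<^sup>2) * norm y ^ (2 * m) \<partial>lborel)"

lemma real_polynomial_function_norm_power:
  "real_polynomial_function (\<lambda>x::'a::euclidean_space. norm x ^ (2 * m))"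
  unfolding power_mult by (rule real_polynomial_function_power[OF real_polynomial_function_norm_square])

lemma gauss_moment_complex:
  "gauss_integral (\<lambda>y::real^'n. of_real (norm y ^ (2 * m))) = of_real (gauss_moment TYPE('n) m)"
  unfolding gauss_moment_def by (rule gauss_integral_of_real)

lemma gauss_integral_const: "gauss_integral (\<lambda>y::real^'n. c) = c * of_real (gauss_moment TYPE('n) 0)"
  using gauss_integral_cmult[of c "\<lambda>y::real^'n. 1"] gauss_moment_complex[where 'n='n, of 0]
  by simp

text \<open>The divergence of the vector field \<open>y |y|\<^sup>2\<^sup>m\<close> is \<open>(n + 2 m) |y|\<^sup>2\<^sup>m\<close>.\<close>

lemma gauss_moment_Suc:
  "gauss_moment TYPE('n) (Suc m) = (real CARD('n::finite) / 2 + real m) * gauss_moment TYPE('n) m"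
proof -
  define F where "F = (\<lambda>y::real^'n. complex_of_real (norm y ^ (2 * m)))"
  have F: "polynomial_function F"
    unfolding F_def by (intro polynomial_function_of_real real_polynomial_function_norm_power)
  have hom: "F (c *\<^sub>R x) = of_real (c ^ (2 * m)) * F x" for c x
  proof -
    have "norm (c *\<^sub>R x) ^ (2 * m) = c ^ (2 * m) * norm x ^ (2 * m)"
      by (simp add: power_mult_distrib power_even_abs)
    then show ?thesis
      unfolding F_def by (simp only: of_real_mult)
  qed
  note poly = F polynomial_function_times polynomial_function_of_real real_polynomial_function_inner
  define V where "V = (\<lambda>e y. of_real (y \<bullet> e) * F y)"
  have div: "partial_deriv e (V e) y = F y + of_real (y \<bullet> e) * partial_deriv e F y"
    if "e \<in> Basis" for e y
    unfolding V_def using that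
    by (subst partial_deriv_times) (auto intro: poly simp: partial_deriv_inner)
  have "(\<lambda>y. \<Sum>e\<in>Basis. partial_deriv e (V e) y) =
      (\<lambda>y. of_nat (CARD('n) + 2 * m) * F y)"
  proof
    fix y :: "real ^ 'n"
    have "(\<Sum>e\<in>Basis. partial_deriv e (V e) y) = of_nat CARD('n) * F y + partial_deriv y F y"
      by (simp add: div sum.distrib partial_deriv_direction[OF F, of y] scaleR_conv_of_real)
    then show "(\<Sum>e\<in>Basis. partial_deriv e (V e) y) = of_nat (CARD('n) + 2 * m) * F y"
      by (simp add: Euler_homogeneous[OF F hom] algebra_simps)
  qed
  then have "of_nat (CARD('n) + 2 * m) * gauss_integral F =
      gauss_integral (\<lambda>y. \<Sum>e\<in>Basis. partial_deriv e (V e) y)"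
    by (simp add: gauss_integral_cmult)
  also have "\<dots> = 2 * gauss_integral (\<lambda>y. \<Sum>e\<in>Basis. of_real (y \<bullet> e) * V e y)"
    unfolding V_def by (intro gauss_integral_divergence polynomial_function_times
        polynomial_function_of_real real_polynomial_function_inner F)
  also have "(\<lambda>y. \<Sum>e\<in>Basis. of_real (y \<bullet> e) * V e y) = (\<lambda>y. of_real (norm y ^ (2 * Suc m)))"
  proof
    fix y :: "real ^ 'n"
    have "(\<Sum>e\<in>Basis. of_real (y \<bullet> e) * V e y) = of_real (\<Sum>e\<in>Basis. (y \<bullet> e) * (y \<bullet> e)) * F y"
      by (simp add: V_def sum_distrib_right mult.assoc)
    also have "(\<Sum>e\<in>Basis. (y \<bullet> e) * (y \<bullet> e)) = (norm y)\<^sup>2"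
      by (metis euclidean_inner power2_norm_eq_inner)
    finally show "(\<Sum>e\<in>Basis. of_real (y \<bullet> e) * V e y) = of_real (norm y ^ (2 * Suc m))"
      by (simp add: F_def power2_eq_square)
  qed
  finally have "complex_of_real (real (CARD('n) + 2 * m) * gauss_moment TYPE('n) m) =
      complex_of_real (2 * gauss_moment TYPE('n) (Suc m))"
    unfolding F_def gauss_moment_complex by simp
  then have "real (CARD('n) + 2 * m) * gauss_moment TYPE('n) m = 2 * gauss_moment TYPE('n) (Suc m)"
    unfolding of_real_eq_iff .
  then show ?thesis
    by (simp add: field_simps)
qed

lemma gauss_moment_pochhammer:
  "gauss_moment TYPE('n) m =
    pochhammer (real CARD('n::finite) / 2) m * gauss_moment TYPE('n) 0"
  by (induction m) (simp_all add: gauss_moment_Suc pochhammer_Suc)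

lemma gauss_moment_pos: "gauss_moment TYPE('n::finite) m > 0"
proof -
  have "integrable lborel (\<lambda>y::real^'n. exp (- (norm y)\<^sup>2))"
    using integrable_gauss[of "\<lambda>y::real^'n. 1::real" 1 0 1] by simp
  then have "gauss_moment TYPE('n) 0 > 0"
    unfolding gauss_moment_def
    by (intro integral_lborel_pos[where ?x0.0=0]) (auto intro!: continuous_intros)
  moreover have "pochhammer (real CARD('n) / 2) m > 0"
    by (intro pochhammer_pos) auto
  ultimately show ?thesis
    using gauss_moment_pochhammer[where 'n='n, of m] by simp
qed

text \<open>The mean value property with respect to the Gaussian probability measure: the integral of
  \<open>f (x + s y)\<close> does not depend on \<open>s\<close>, because after an integration by parts its derivative in
  \<open>s\<close> is a multiple of the integral of the Laplacian.\<close>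

lemma gauss_mean_value:
  fixes f :: "real ^ 'n \<Rightarrow> complex"
  assumes f: "polynomial_function f" and harm: "\<And>x. laplacian f x = 0"
  shows "gauss_integral (\<lambda>y. f (x + y)) = f x * of_real (gauss_moment TYPE('n) 0)"
proof -
  have "\<forall>e. \<exists>C a. C \<ge> 0 \<and> a \<ge> 0 \<and> (\<forall>z. norm (partial_deriv e f z) \<le> C * exp (a * norm z))"
  proof
    fix e
    show "\<exists>C a. C \<ge> 0 \<and> a \<ge> 0 \<and> (\<forall>z. norm (partial_deriv e f z) \<le> C * exp (a * norm z))"
      by (rule polynomial_function_exp_bound[OF polynomial_function_partial_deriv[OF f], of e]) blast
  qed
  from choice[OF this] obtain Cf where
      "\<forall>e. \<exists>a. Cf e \<ge> 0 \<and> a \<ge> 0 \<and> (\<forall>z. norm (partial_deriv e f z) \<le> Cf e * exp (a * norm z))"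
    by blast
  from choice[OF this] obtain af where
      bd: "\<And>e. Cf e \<ge> 0" "\<And>e. af e \<ge> 0"
        "\<And>e z. norm (partial_deriv e f z) \<le> Cf e * exp (af e * norm z)"
    by blast
  define C where "C = (\<Sum>e\<in>Basis. Cf e)"
  define a where "a = (\<Sum>e\<in>Basis. af e)"
  have C: "C \<ge> 0" and a: "a \<ge> 0"
    unfolding C_def a_def by (auto intro: sum_nonneg bd)
  have bound: "norm (partial_deriv e f z) \<le> C * exp (a * norm z)" if "e \<in> Basis" for e z
  proof -
    have "Cf e \<le> C" "af e \<le> a"
      unfolding C_def a_def using that by (auto intro: member_le_sum bd)
    then have "Cf e * exp (af e * norm z) \<le> C * exp (a * norm z)"
      using bd C by (intro mult_mono) (auto intro: mult_right_mono)
    with bd(3)[of e z] show ?thesis by linarith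
  qed
  define \<Phi> where "\<Phi> = (\<lambda>s y. exp (- (norm y)\<^sup>2) *\<^sub>R f (x + s *\<^sub>R y))"
  define \<Phi>' where "\<Phi>' = (\<lambda>s y. exp (- (norm y)\<^sup>2) *\<^sub>R partial_deriv y f (x + s *\<^sub>R y))"
  define K where "K = real CARD('n) * C * exp (a * norm x)"
  have "(\<integral>y. \<Phi> 1 y - \<Phi> 0 y \<partial>lborel) = 0"
  proof (rule integral_difference_of_derivative)
    fix s y
    show "((\<lambda>s. \<Phi> s y) has_vector_derivative \<Phi>' s y) (at s)"
      unfolding \<Phi>_def \<Phi>'_def
      by (intro bounded_linear.has_vector_derivative[OF bounded_linear_scaleR_right]
          has_vector_derivative_along_line f)
  next
    have "continuous_on UNIV (\<lambda>p. partial_deriv e f (x + fst p *\<^sub>R snd p))" for e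
    proof -
      have "continuous_on UNIV (partial_deriv e f)"
        by (intro continuous_on_polymonial_function polynomial_function_partial_deriv f)
      then show ?thesis
        by (rule continuous_on_compose2) (auto intro!: continuous_intros)
    qed
    then show "continuous_on UNIV (\<lambda>(s, y). \<Phi>' s y)"
      unfolding \<Phi>'_def case_prod_unfold
      by (subst partial_deriv_direction[OF f]) (intro continuous_intros)
  next
    fix s :: real and y :: "real ^ 'n" assume s: "0 \<le> s" "s \<le> 1"
    have "norm (x + s *\<^sub>R y) \<le> norm x + norm (s *\<^sub>R y)"
      by (rule norm_triangle_ineq)
    also have "norm (s *\<^sub>R y) \<le> norm y"
      using s by (simp add: mult_left_le_one_le)
    finally have "a * norm (x + s *\<^sub>R y) \<le> a * norm x + a * norm y"
      using a by (simp add: distrib_left[symmetric] mult_left_mono)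
    then have "exp (a * norm (x + s *\<^sub>R y)) \<le> exp (a * norm x) * exp (a * norm y)"
      by (simp add: exp_add[symmetric])
    then have b: "C * exp (a * norm (x + s *\<^sub>R y)) \<le> C * (exp (a * norm x) * exp (a * norm y))"
      using C by (rule mult_left_mono)
    have y: "norm y \<le> exp (norm y)"
      using exp_ge_add_one_self[of "norm y"] by linarith
    have "norm (partial_deriv y f (x + s *\<^sub>R y)) \<le>
        (\<Sum>e\<in>(Basis::(real^'n) set). exp (norm y) * (C * (exp (a * norm x) * exp (a * norm y))))"
      unfolding partial_deriv_direction[OF f, of y]
    proof (rule sum_norm_le)
      fix e :: "real ^ 'n" assume e: "e \<in> Basis"
      have "\<bar>y \<bullet> e\<bar> \<le> exp (norm y)"
        using Basis_le_norm[OF e, of y] y by linarith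
      moreover have "norm (partial_deriv e f (x + s *\<^sub>R y)) \<le> C * (exp (a * norm x) * exp (a * norm y))"
        using bound[OF e] b order_trans by blast
      ultimately show "norm ((y \<bullet> e) *\<^sub>R partial_deriv e f (x + s *\<^sub>R y)) \<le>
          exp (norm y) * (C * (exp (a * norm x) * exp (a * norm y)))"
        unfolding norm_scaleR by (intro mult_mono) auto
    qed
    also have "\<dots> = K * exp ((a + 1) * norm y)"
      by (simp add: K_def distrib_right exp_add)
    finally show "norm (\<Phi>' s y) \<le> exp (- (1 * (norm y)\<^sup>2)) *\<^sub>R (K * exp ((a + 1) * norm y))"
      by (simp add: \<Phi>'_def)
  next
    show "integrable lborel (\<lambda>y::real^'n. exp (- (1 * (norm y)\<^sup>2)) *\<^sub>R (K * exp ((a + 1) * norm y)))"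
      by (rule integrable_gauss[where C=K and a="a+1"]) (auto simp: K_def C)
  next
    fix s
    define V where "V = (\<lambda>e y. partial_deriv e f (x + s *\<^sub>R y))"
    have V: "polynomial_function (V e)" for e
      unfolding V_def by (intro polynomial_function_shift polynomial_function_partial_deriv f)
    have "partial_deriv e (V e) y = s *\<^sub>R partial_deriv e (partial_deriv e f) (x + s *\<^sub>R y)" for e y
      unfolding V_def by (intro partial_deriv_shift polynomial_function_partial_deriv f)
    then have "(\<lambda>y. \<Sum>e\<in>Basis. partial_deriv e (V e) y) = (\<lambda>y. s *\<^sub>R laplacian f (x + s *\<^sub>R y))"
      by (simp add: laplacian_def scaleR_sum_right)
    then have "gauss_integral (\<lambda>y. \<Sum>e\<in>Basis. of_real (y \<bullet> e) * V e y) = 0"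
      using gauss_integral_divergence[of V, OF V] by (simp add: harm gauss_integral_def)
    moreover have "(\<lambda>y. \<Sum>e\<in>Basis. of_real (y \<bullet> e) * V e y) =
        (\<lambda>y. partial_deriv y f (x + s *\<^sub>R y))"
      by (intro ext, subst partial_deriv_direction[OF f])
         (simp add: V_def scaleR_conv_of_real[where 'a=complex])
    ultimately show "(\<integral>y. \<Phi>' s y \<partial>lborel) = 0"
      by (simp add: gauss_integral_def \<Phi>'_def)
  qed
  moreover have "integrable lborel (\<Phi> s)" for s
    unfolding \<Phi>_def by (intro integrable_gauss_integral polynomial_function_shift f)
  ultimately have "(\<integral>y. \<Phi> 1 y \<partial>lborel) = (\<integral>y. \<Phi> 0 y \<partial>lborel)"
    by simp
  then show ?thesis
    using gauss_integral_const[of "f x", where 'n='n] by (simp add: \<Phi>_def gauss_integral_def)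
qed

text \<open>The Hermitian inner product with weight \<open>exp (- |y|\<^sup>2)\<close>, linear in the first argument, and
  the square of its norm as a real number.\<close>

definition gauss_inner :: "(real ^ 'n \<Rightarrow> complex) \<Rightarrow> (real ^ 'n \<Rightarrow> complex) \<Rightarrow> complex" where
  "gauss_inner p q = gauss_integral (\<lambda>y. p y * cnj (q y))"

definition gauss_norm_sq :: "(real ^ 'n \<Rightarrow> complex) \<Rightarrow> real" where
  "gauss_norm_sq p = (\<integral>y. exp (- (norm y)\<^sup>2) * (norm (p y))\<^sup>2 \<partial>lborel)"

lemma gauss_inner_self: "gauss_inner p p = of_real (gauss_norm_sq p)"
proof -
  have "(\<lambda>y. p y * cnj (p y)) = (\<lambda>y. complex_of_real ((norm (p y))\<^sup>2))"
    by (intro ext) (simp only: complex_norm_square)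
  then show ?thesis
    unfolding gauss_inner_def gauss_norm_sq_def by (simp only: gauss_integral_of_real)
qed

lemma gauss_norm_sq_nonneg: "gauss_norm_sq p \<ge> 0"
  by (simp add: gauss_norm_sq_def)

lemma polynomial_function_cmult:
  fixes f :: "'a::euclidean_space \<Rightarrow> complex"
  assumes "polynomial_function f"
  shows "polynomial_function (\<lambda>x. c * f x)"
  by (rule polynomial_function_times[OF polynomial_function_const assms])

lemma gauss_inner_commute: "gauss_inner q p = cnj (gauss_inner p q)"
  by (simp add: gauss_inner_def flip: gauss_integral_cnj) (simp add: mult.commute)

lemma gauss_inner_cmult_left: "gauss_inner (\<lambda>x. c * p x) q = c * gauss_inner p q"
  by (simp add: gauss_inner_def mult.assoc gauss_integral_cmult)

lemma gauss_inner_diff_left: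
  assumes "polynomial_function p" "polynomial_function q" "polynomial_function r"
  shows "gauss_inner (\<lambda>x. p x - q x) r = gauss_inner p r - gauss_inner q r"
  unfolding gauss_inner_def left_diff_distrib
  by (intro gauss_integral_diff polynomial_function_times polynomial_function_cnj assms)

lemma gauss_inner_sum_left:
  assumes "\<And>i. i \<in> I \<Longrightarrow> polynomial_function (p i)" "polynomial_function r"
  shows "gauss_inner (\<lambda>x. \<Sum>i\<in>I. p i x) r = (\<Sum>i\<in>I. gauss_inner (p i) r)"
  unfolding gauss_inner_def sum_distrib_right
  by (intro gauss_integral_sum polynomial_function_times polynomial_function_cnj assms)

lemma gauss_norm_sq_cmult: "gauss_norm_sq (\<lambda>x. c * p x) = (norm c)\<^sup>2 * gauss_norm_sq p"
  by (simp add: gauss_norm_sq_def norm_mult power_mult_distrib mult.left_commute)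

lemma integrable_gauss_norm_sq:
  fixes p :: "real ^ 'n \<Rightarrow> complex"
  assumes "polynomial_function p" "s > 0"
  shows "integrable lborel (\<lambda>y. exp (- (s * (norm y)\<^sup>2)) * (norm (p y))\<^sup>2)"
proof -
  have "polynomial_function (\<lambda>y. p y * cnj (p y))"
    by (intro polynomial_function_times polynomial_function_cnj assms)
  from integrable_norm[OF integrable_gauss_polynomial[OF this \<open>s > 0\<close>]] show ?thesis
    by (simp add: norm_mult power2_eq_square)
qed

text \<open>The Cauchy--Schwarz inequality for the mean value property, obtained from the nonnegative
  squared norm of \<open>y \<mapsto> f (x + y) - f x\<close>.\<close>

lemma gauss_mean_value_square:
  fixes f :: "real ^ 'n \<Rightarrow> complex"
  assumes f: "polynomial_function f" and harm: "\<And>x. laplacian f x = 0"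
  shows "(norm (f x))\<^sup>2 * gauss_moment TYPE('n) 0 \<le> gauss_norm_sq (\<lambda>y. f (x + y))"
proof -
  define g where "g = (\<lambda>y. f (x + y))"
  define c where "c = f x"
  define m where "m = complex_of_real (gauss_moment TYPE('n) 0)"
  have g: "polynomial_function g"
    using polynomial_function_shift[OF f, of x 1] by (simp add: g_def)
  have one: "polynomial_function (\<lambda>y::real^'n. c)" by simp
  have gc: "gauss_inner g (\<lambda>y. c) = c * m * cnj c"
  proof -
    have "(\<lambda>y. g y * cnj c) = (\<lambda>y. cnj c * g y)"
      by (simp add: mult.commute)
    then show ?thesis
      using gauss_mean_value[OF f harm, of x]
      by (simp add: gauss_inner_def gauss_integral_cmult g_def c_def m_def)
  qed
  have cc: "gauss_inner (\<lambda>y::real^'n. c) (\<lambda>y. c) = c * m * cnj c"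
    by (simp add: gauss_inner_def gauss_integral_const m_def)
  have d: "polynomial_function (\<lambda>y. g y - c)"
    by (intro polynomial_function_diff g one)
  have "complex_of_real (gauss_norm_sq (\<lambda>y. g y - c)) =
      gauss_inner (\<lambda>y. g y - c) (\<lambda>y. g y - c)"
    by (simp add: gauss_inner_self)
  also have "\<dots> = gauss_inner g (\<lambda>y. g y - c) - gauss_inner (\<lambda>y. c) (\<lambda>y. g y - c)"
    by (intro gauss_inner_diff_left g one d)
  also have "gauss_inner g (\<lambda>y. g y - c) = cnj (gauss_inner (\<lambda>y. g y - c) g)"
    by (rule gauss_inner_commute)
  also have "gauss_inner (\<lambda>y. g y - c) g = gauss_inner g g - gauss_inner (\<lambda>y. c) g"
    by (intro gauss_inner_diff_left g one)
  also have "gauss_inner (\<lambda>y. c) g = cnj (gauss_inner g (\<lambda>y. c))"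
    by (rule gauss_inner_commute)
  also have "gauss_inner (\<lambda>y. c) (\<lambda>y. g y - c) = cnj (gauss_inner (\<lambda>y. g y - c) (\<lambda>y. c))"
    by (rule gauss_inner_commute)
  also have "gauss_inner (\<lambda>y. g y - c) (\<lambda>y. c) = gauss_inner g (\<lambda>y. c) - gauss_inner (\<lambda>y::real^'n. c) (\<lambda>y. c)"
    by (intro gauss_inner_diff_left g one)
  also have "cnj (gauss_inner g g - cnj (gauss_inner g (\<lambda>y. c))) -
      cnj (gauss_inner g (\<lambda>y. c) - gauss_inner (\<lambda>y::real^'n. c) (\<lambda>y. c)) =
      gauss_inner g g - (c * cnj c) * m"
    by (simp add: gc cc gauss_inner_self mult.commute mult.left_commute m_def)
  also have "\<dots> = complex_of_real (gauss_norm_sq g - (norm c)\<^sup>2 * gauss_moment TYPE('n) 0)"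
  proof -
    have "c * cnj c = complex_of_real ((norm c)\<^sup>2)"
      by (simp only: complex_norm_square)
    then show ?thesis
      by (simp add: gauss_inner_self m_def)
  qed
  finally have "gauss_norm_sq (\<lambda>y. g y - c) = gauss_norm_sq g - (norm c)\<^sup>2 * gauss_moment TYPE('n) 0"
    unfolding of_real_eq_iff .
  then show ?thesis
    using gauss_norm_sq_nonneg[of "\<lambda>y. g y - c"] by (simp add: g_def c_def)
qed

text \<open>Centring the Gaussian at \<open>0\<close> instead of \<open>x\<close> costs the factor \<open>exp (|x|\<^sup>2)\<close> and half of the
  exponent, because \<open>|z|\<^sup>2 \<le> 2 |z - x|\<^sup>2 + 2 |x|\<^sup>2\<close>; homogeneity restores the exponent at the cost of
  the factor \<open>2\<^sup>k\<close>.\<close>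

lemma homogeneous_harmonic_growth:
  fixes p :: "real ^ 'n \<Rightarrow> complex"
  assumes p: "p \<in> homogeneous_harmonic_polynomials k"
  shows "(norm (p x))\<^sup>2 * gauss_moment TYPE('n) 0 \<le>
    exp ((norm x)\<^sup>2) * (2 ^ k * sqrt 2 ^ CARD('n)) * gauss_norm_sq p"
proof -
  note P = homogeneous_harmonic_polynomialsD[OF p]
  have px: "polynomial_function (\<lambda>y. p (x + y))"
    using polynomial_function_shift[OF P(1), of x 1] by simp
  have [measurable]: "p \<in> borel_measurable borel"
    by (rule borel_measurable_polynomial_function[OF P(1)])
  have "(norm (p x))\<^sup>2 * gauss_moment TYPE('n) 0 \<le> gauss_norm_sq (\<lambda>y. p (x + y))"
    by (rule gauss_mean_value_square[OF P(1,3)])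
  also have "\<dots> = (\<integral>y. exp (- (norm ((y + x) - x))\<^sup>2) * (norm (p (y + x)))\<^sup>2 \<partial>lborel)"
    by (simp add: gauss_norm_sq_def add.commute)
  also have "\<dots> = (\<integral>z. exp (- (norm (z - x))\<^sup>2) * (norm (p z))\<^sup>2 \<partial>lborel)"
    by (rule integral_lborel_translate[where f="\<lambda>z. exp (- (norm (z - x))\<^sup>2) * (norm (p z))\<^sup>2"])
       measurable
  also have "\<dots> \<le> (\<integral>z. exp ((norm x)\<^sup>2) * (exp (- (1/2 * (norm z)\<^sup>2)) * (norm (p z))\<^sup>2) \<partial>lborel)"
  proof (rule integral_mono)
    have "integrable lborel (\<lambda>y. exp (- (norm ((y + x) - x))\<^sup>2) * (norm (p (y + x)))\<^sup>2)"
      using integrable_gauss_norm_sq[OF px, of 1] by (simp add: add.commute)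
    then show "integrable lborel (\<lambda>z. exp (- (norm (z - x))\<^sup>2) * (norm (p z))\<^sup>2)"
      by (subst (asm) integrable_lborel_translate[where f="\<lambda>z. exp (- (norm (z - x))\<^sup>2) * (norm (p z))\<^sup>2"])
         measurable
  next
    show "integrable lborel (\<lambda>z. exp ((norm x)\<^sup>2) * (exp (- (1/2 * (norm z)\<^sup>2)) * (norm (p z))\<^sup>2))"
      by (intro integrable_mult_right integrable_gauss_norm_sq P) simp
  next
    fix z :: "real ^ 'n"
    have "norm z \<le> norm (z - x) + norm x"
      by (metis diff_add_cancel norm_triangle_ineq)
    then have "(norm z)\<^sup>2 \<le> (norm (z - x) + norm x)\<^sup>2"
      by (rule power_mono) simp
    also have "\<dots> \<le> 2 * (norm (z - x))\<^sup>2 + 2 * (norm x)\<^sup>2"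
      using sum_squares_bound[of "norm (z - x)" "norm x"] by (simp add: power2_sum)
    finally have "exp (- (norm (z - x))\<^sup>2) \<le> exp ((norm x)\<^sup>2) * exp (- (1/2 * (norm z)\<^sup>2))"
      by (simp flip: exp_add)
    then show "exp (- (norm (z - x))\<^sup>2) * (norm (p z))\<^sup>2 \<le>
        exp ((norm x)\<^sup>2) * (exp (- (1/2 * (norm z)\<^sup>2)) * (norm (p z))\<^sup>2)"
      by (simp add: mult.assoc[symmetric] mult_right_mono)
  qed
  also have "\<dots> = exp ((norm x)\<^sup>2) * (\<integral>z. exp (- (1/2 * (norm z)\<^sup>2)) * (norm (p z))\<^sup>2 \<partial>lborel)"
    by simp
  also have "(\<integral>z. exp (- (1/2 * (norm z)\<^sup>2)) * (norm (p z))\<^sup>2 \<partial>lborel) =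
      sqrt 2 ^ CARD('n) * (\<integral>z. exp (- (1/2 * (norm (sqrt 2 *\<^sub>R z))\<^sup>2)) * (norm (p (sqrt 2 *\<^sub>R z)))\<^sup>2 \<partial>lborel)"
    by (subst integral_lborel_scale[where r="sqrt 2"]) auto
  also have "(\<lambda>z. exp (- (1/2 * (norm (sqrt 2 *\<^sub>R z))\<^sup>2)) * (norm (p (sqrt 2 *\<^sub>R z)))\<^sup>2) =
      (\<lambda>z. 2 ^ k * (exp (- (norm z)\<^sup>2) * (norm (p z))\<^sup>2))"
  proof
    fix z :: "real ^ 'n"
    have "(sqrt 2 ^ k)\<^sup>2 = (2::real) ^ k"
      by (metis power_mult mult.commute real_sqrt_pow2 zero_le_numeral)
    then show "exp (- (1/2 * (norm (sqrt 2 *\<^sub>R z))\<^sup>2)) * (norm (p (sqrt 2 *\<^sub>R z)))\<^sup>2 =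
        2 ^ k * (exp (- (norm z)\<^sup>2) * (norm (p z))\<^sup>2)"
      by (simp add: P norm_mult norm_power power_mult_distrib)
  qed
  finally show ?thesis
    by (simp add: gauss_norm_sq_def mult_ac)
qed

text \<open>The previous bound is applied at the multiple of \<open>x\<close> of norm \<open>sqrt k\<close>, where
  \<open>exp (|x|\<^sup>2) |x|\<^sup>-\<^sup>2\<^sup>k\<close> is smallest. The factorial gained in this way is what makes the kernel
  series converge: the norm of a polynomial of degree \<open>k\<close> already contains a moment of factorial
  size.\<close>

lemma homogeneous_harmonic_eval_bound:
  fixes p :: "real ^ 'n \<Rightarrow> complex"
  assumes p: "p \<in> homogeneous_harmonic_polynomials k"
  shows "(norm (p x))\<^sup>2 * (fact k * gauss_moment TYPE('n) 0) \<le>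
    ((2 * exp 1) ^ k * sqrt 2 ^ CARD('n)) * norm x ^ (2 * k) * gauss_norm_sq p"
proof (cases "x = 0")
  case True
  show ?thesis
  proof (cases "k = 0")
    case False
    then have "p 0 = 0"
      using homogeneous_harmonic_polynomialsD(2)[OF p, of 0 0] by (auto simp: power_0_left)
    then show ?thesis
      using True False by (simp add: gauss_norm_sq_nonneg)
  qed (use True homogeneous_harmonic_growth[OF p, of 0] in simp)
next
  case False
  define c where "c = sqrt (real k) / norm x"
  have c2: "c\<^sup>2 * (norm x)\<^sup>2 = real k"
    using False by (simp add: c_def power_divide)
  have fact_le: "fact k \<le> (real k) ^ k"
    using fact_le_power[of k, where 'a=real] by simp
  have "(norm (p x))\<^sup>2 * (fact k * gauss_moment TYPE('n) 0) \<le>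
      (norm (p x))\<^sup>2 * ((real k) ^ k * gauss_moment TYPE('n) 0)"
    using gauss_moment_pos[where 'n='n, of 0] fact_le
    by (intro mult_left_mono mult_right_mono) auto
  also have "real k ^ k = c ^ (2 * k) * norm x ^ (2 * k)"
    by (simp add: c2[symmetric] power_mult_distrib power_mult)
  also have "(norm (p x))\<^sup>2 * (c ^ (2 * k) * norm x ^ (2 * k) * gauss_moment TYPE('n) 0) =
      norm x ^ (2 * k) * ((norm (p (c *\<^sub>R x)))\<^sup>2 * gauss_moment TYPE('n) 0)"
    by (simp add: homogeneous_harmonic_polynomialsD(2)[OF p] norm_mult norm_power power_mult_distrib
        power_mult[symmetric] mult.commute[of k 2] power_even_abs)
  also have "\<dots> \<le> norm x ^ (2 * k) *
      (exp ((norm (c *\<^sub>R x))\<^sup>2) * (2 ^ k * sqrt 2 ^ CARD('n)) * gauss_norm_sq p)"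
    by (intro mult_left_mono homogeneous_harmonic_growth p) simp
  also have "exp ((norm (c *\<^sub>R x))\<^sup>2) = exp 1 ^ k"
    using c2 by (simp add: power_mult_distrib exp_of_nat_mult[symmetric])
  finally show ?thesis
    by (simp add: power_mult_distrib mult_ac)
qed

text \<open>A finite family, given as a set, of homogeneous harmonic polynomials of degree \<open>k\<close> that is
  orthonormal for the Gaussian inner product.\<close>

definition orthonormal_harmonics :: "nat \<Rightarrow> (real ^ 'n \<Rightarrow> complex) set \<Rightarrow> bool" where
  "orthonormal_harmonics k S \<longleftrightarrow> finite S \<and> S \<subseteq> homogeneous_harmonic_polynomials k \<and>
     (\<forall>p\<in>S. \<forall>q\<in>S. gauss_inner p q = (if p = q then 1 else 0))"

text \<open>The evaluation bound for \<open>y \<mapsto> \<Sum>q\<in>S. cnj (q x) * q y\<close>, whose value at \<open>x\<close> and whose squared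
  norm are both the sum on the left-hand side.\<close>

lemma orthonormal_harmonics_bessel:
  fixes S :: "(real ^ 'n \<Rightarrow> complex) set"
  assumes S: "orthonormal_harmonics k S"
  shows "(\<Sum>q\<in>S. (norm (q x))\<^sup>2) * (fact k * gauss_moment TYPE('n) 0) \<le>
    ((2 * exp 1) ^ k * sqrt 2 ^ CARD('n)) * norm x ^ (2 * k)"
proof -
  define T where "T = (\<Sum>q\<in>S. (norm (q x))\<^sup>2)"
  define p where "p = (\<lambda>y. \<Sum>q\<in>S. cnj (q x) * q y)"
  have fin: "finite S" and hh: "\<And>q. q \<in> S \<Longrightarrow> q \<in> homogeneous_harmonic_polynomials k"
    and on: "\<And>q r. q \<in> S \<Longrightarrow> r \<in> S \<Longrightarrow> gauss_inner q r = (if q = r then 1 else 0)"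
    using S by (auto simp: orthonormal_harmonics_def)
  note poly = homogeneous_harmonic_polynomialsD(1)[OF hh]
  have p: "p \<in> homogeneous_harmonic_polynomials k"
    unfolding p_def
    by (intro homogeneous_harmonic_polynomials_sum homogeneous_harmonic_polynomials_cmult hh fin)
  have px: "p x = of_real T"
    by (simp add: p_def T_def complex_norm_square mult.commute flip: of_real_power)
  have pr: "gauss_inner p r = cnj (r x)" if r: "r \<in> S" for r
  proof -
    have "gauss_inner p r = (\<Sum>q\<in>S. gauss_inner (\<lambda>y. cnj (q x) * q y) r)"
      unfolding p_def by (intro gauss_inner_sum_left polynomial_function_cmult poly r)
    also have "\<dots> = (\<Sum>q\<in>S. if q = r then cnj (q x) else 0)"
      by (intro sum.cong refl) (simp add: gauss_inner_cmult_left on r)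
    finally show ?thesis
      using fin r by simp
  qed
  have "gauss_inner p p = (\<Sum>q\<in>S. gauss_inner (\<lambda>y. cnj (q x) * q y) p)"
    by (subst p_def, intro gauss_inner_sum_left polynomial_function_cmult poly
        homogeneous_harmonic_polynomialsD(1)[OF p])
  also have "\<dots> = (\<Sum>q\<in>S. cnj (q x) * cnj (gauss_inner p q))"
    by (intro sum.cong refl) (simp add: gauss_inner_cmult_left gauss_inner_commute[of _ p])
  also have "\<dots> = of_real T"
    by (simp add: pr T_def complex_norm_square mult.commute flip: of_real_power)
  finally have "gauss_norm_sq p = T"
    by (simp add: gauss_inner_self)
  then have *: "T\<^sup>2 * (fact k * gauss_moment TYPE('n) 0) \<le>
      ((2 * exp 1) ^ k * sqrt 2 ^ CARD('n)) * norm x ^ (2 * k) * T"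
    using homogeneous_harmonic_eval_bound[OF p, of x] by (simp add: px)
  show ?thesis
  proof (cases "T = 0")
    case True
    then show ?thesis by (simp add: T_def)
  next
    case False
    moreover have "T \<ge> 0" by (simp add: T_def sum_nonneg)
    ultimately have "T > 0" by simp
    with * have "T * (T * (fact k * gauss_moment TYPE('n) 0)) \<le>
        T * (((2 * exp 1) ^ k * sqrt 2 ^ CARD('n)) * norm x ^ (2 * k))"
      by (simp add: power2_eq_square mult_ac)
    then show ?thesis
      unfolding T_def[symmetric] using \<open>T > 0\<close> by (simp only: mult_le_cancel_left_pos)
  qed
qed

text \<open>Integrating the pointwise inequality bounds the dimension, without recourse to a basis of the
  space of homogeneous polynomials.\<close>

lemma orthonormal_harmonics_card_bound:
  "\<exists>B. \<forall>S. orthonormal_harmonics k (S :: (real ^ 'n \<Rightarrow> complex) set) \<longrightarrow> card S < B"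
proof -
  define D where "D = ((2 * exp 1) ^ k * sqrt 2 ^ CARD('n)) / (fact k * gauss_moment TYPE('n) 0)"
  have pos: "fact k * gauss_moment TYPE('n) 0 > 0"
    using gauss_moment_pos[where 'n='n, of 0] by simp
  have card: "real (card S) \<le> D * gauss_moment TYPE('n) k" if S: "orthonormal_harmonics k S"
    for S :: "(real ^ 'n \<Rightarrow> complex) set"
  proof -
    have poly: "polynomial_function q" if "q \<in> S" for q
      using S that by (auto simp: orthonormal_harmonics_def dest: homogeneous_harmonic_polynomialsD)
    have int: "integrable lborel (\<lambda>y. exp (- (norm y)\<^sup>2) * (norm (q y))\<^sup>2)" if "q \<in> S" for q
      using integrable_gauss_norm_sq[OF poly[OF that], of 1] by simp
    have "gauss_norm_sq q = 1" if "q \<in> S" for q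
      using S that gauss_inner_self[of q] unfolding orthonormal_harmonics_def
      by (metis of_real_eq_1_iff)
    then have "real (card S) = (\<Sum>q\<in>S. gauss_norm_sq q)"
      by simp
    also have "\<dots> = (\<integral>y. (\<Sum>q\<in>S. exp (- (norm y)\<^sup>2) * (norm (q y))\<^sup>2) \<partial>lborel)"
      unfolding gauss_norm_sq_def using int by (subst Bochner_Integration.integral_sum) auto
    also have "\<dots> \<le> (\<integral>y. D * (exp (- (norm (y :: real ^ 'n))\<^sup>2) * norm y ^ (2 * k)) \<partial>lborel)"
    proof (rule integral_mono)
      show "integrable lborel (\<lambda>y. \<Sum>q\<in>S. exp (- (norm y)\<^sup>2) * (norm (q y))\<^sup>2)"
        using int by simp
      have "integrable lborel (\<lambda>y::real^'n. exp (- (norm y)\<^sup>2) *\<^sub>R complex_of_real (norm y ^ (2 * k)))"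
        by (intro integrable_gauss_integral polynomial_function_of_real real_polynomial_function_norm_power)
      from integrable_norm[OF this]
      have "integrable lborel (\<lambda>y::real^'n. exp (- (norm y)\<^sup>2) * norm y ^ (2 * k))"
        by (simp add: norm_power)
      then show "integrable lborel (\<lambda>y::real^'n. D * (exp (- (norm y)\<^sup>2) * norm y ^ (2 * k)))"
        by (rule integrable_mult_right)
      fix y :: "real ^ 'n"
      have "(\<Sum>q\<in>S. (norm (q y))\<^sup>2) \<le> D * norm y ^ (2 * k)"
        using orthonormal_harmonics_bessel[OF S, of y] pos by (simp add: D_def field_simps)
      then have "exp (- (norm y)\<^sup>2) * (\<Sum>q\<in>S. (norm (q y))\<^sup>2) \<le>
          exp (- (norm y)\<^sup>2) * (D * norm y ^ (2 * k))"
        by (rule mult_left_mono) simp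
      then show "(\<Sum>q\<in>S. exp (- (norm y)\<^sup>2) * (norm (q y))\<^sup>2) \<le>
          D * (exp (- (norm y)\<^sup>2) * norm y ^ (2 * k))"
        by (simp add: sum_distrib_left mult.left_commute)
    qed
    also have "\<dots> = D * gauss_moment TYPE('n) k"
      by (simp add: gauss_moment_def)
    finally show ?thesis .
  qed
  have "card S < nat \<lceil>D * gauss_moment TYPE('n) k\<rceil> + 1" if "orthonormal_harmonics k S"
    for S :: "(real ^ 'n \<Rightarrow> complex) set"
    using card[OF that] real_nat_ceiling_ge[of "D * gauss_moment TYPE('n) k"] by linarith
  then show ?thesis by blast
qed

lemma orthonormal_harmonics_complete:
  obtains S :: "(real ^ 'n \<Rightarrow> complex) set" where
    "orthonormal_harmonics k S"
    "\<And>p x. p \<in> homogeneous_harmonic_polynomials k \<Longrightarrow> p x = (\<Sum>q\<in>S. gauss_inner p q * q x)"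
proof -
  \<comment> \<open>A family of maximal cardinality is complete: a nonzero remainder could be normalized and added.\<close>
  obtain B where B: "\<And>S. orthonormal_harmonics k (S :: (real ^ 'n \<Rightarrow> complex) set) \<Longrightarrow> card S < B"
    using orthonormal_harmonics_card_bound by blast
  have "orthonormal_harmonics k ({} :: (real ^ 'n \<Rightarrow> complex) set)"
    by (simp add: orthonormal_harmonics_def)
  then have "\<exists>S :: (real ^ 'n \<Rightarrow> complex) set. orthonormal_harmonics k S \<and>
      (\<forall>T :: (real ^ 'n \<Rightarrow> complex) set. orthonormal_harmonics k T \<longrightarrow> card T \<le> card S)"
    by (rule Lattices_Big.ex_has_greatest_nat
        [where P="orthonormal_harmonics k :: (real ^ 'n \<Rightarrow> complex) set \<Rightarrow> bool" and b=B]) (simp add: B)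
  then obtain S :: "(real ^ 'n \<Rightarrow> complex) set" where S: "orthonormal_harmonics k S"
    and max: "\<And>T :: (real ^ 'n \<Rightarrow> complex) set. orthonormal_harmonics k T \<Longrightarrow> card T \<le> card S"
    by blast
  have fin: "finite S" and hh: "\<And>q. q \<in> S \<Longrightarrow> q \<in> homogeneous_harmonic_polynomials k"
    and on: "\<And>q r. q \<in> S \<Longrightarrow> r \<in> S \<Longrightarrow> gauss_inner q r = (if q = r then 1 else 0)"
    using S by (auto simp: orthonormal_harmonics_def)
  note poly = homogeneous_harmonic_polynomialsD(1)
  have "p x = (\<Sum>q\<in>S. gauss_inner p q * q x)"
    if p: "p \<in> homogeneous_harmonic_polynomials k" for p x
  proof -
    define P where "P = (\<lambda>y. \<Sum>q\<in>S. gauss_inner p q * q y)"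
    define r where "r = (\<lambda>y. p y - P y)"
    have P: "P \<in> homogeneous_harmonic_polynomials k"
      unfolding P_def by (intro homogeneous_harmonic_polynomials_sum
          homogeneous_harmonic_polynomials_cmult hh fin)
    have r: "r \<in> homogeneous_harmonic_polynomials k"
      unfolding r_def by (intro homogeneous_harmonic_polynomials_diff p P)
    have orth: "gauss_inner r q = 0" if q: "q \<in> S" for q
    proof -
      have "gauss_inner P q = (\<Sum>u\<in>S. gauss_inner (\<lambda>y. gauss_inner p u * u y) q)"
        unfolding P_def
        by (intro gauss_inner_sum_left polynomial_function_cmult poly[OF hh] q)
      also have "\<dots> = (\<Sum>u\<in>S. if u = q then gauss_inner p u else 0)"
        by (intro sum.cong refl) (simp add: gauss_inner_cmult_left on q)
      finally have "gauss_inner P q = gauss_inner p q"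
        using fin q by simp
      then show ?thesis
        unfolding r_def by (simp add: gauss_inner_diff_left poly[OF p] poly[OF P] poly[OF hh[OF q]])
    qed
    have "gauss_norm_sq r = 0"
    proof (rule ccontr)
      assume "gauss_norm_sq r \<noteq> 0"
      then have N: "gauss_norm_sq r > 0"
        using gauss_norm_sq_nonneg[of r] by simp
      define c where "c = complex_of_real (1 / sqrt (gauss_norm_sq r))"
      have c: "(norm c)\<^sup>2 * gauss_norm_sq r = 1"
        using N by (simp add: c_def power_divide norm_divide)
      define u where "u = (\<lambda>y. c * r y)"
      have u: "u \<in> homogeneous_harmonic_polynomials k"
        unfolding u_def by (intro homogeneous_harmonic_polynomials_cmult r)
      have uq: "gauss_inner u q = 0" "gauss_inner q u = 0" if "q \<in> S" for q
        using orth[OF that] gauss_inner_commute[of q u]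
        by (simp_all add: u_def gauss_inner_cmult_left)
      have uu: "gauss_inner u u = 1"
        by (simp add: gauss_inner_self u_def gauss_norm_sq_cmult c)
      have "u \<notin> S"
        using uq uu by fastforce
      moreover have "orthonormal_harmonics k (insert u S)"
        using fin hh on u uq uu \<open>u \<notin> S\<close> by (auto simp: orthonormal_harmonics_def)
      ultimately show False
        using max[of "insert u S"] fin by simp
    qed
    then have le: "(norm (r x))\<^sup>2 * (fact k * gauss_moment TYPE('n) 0) \<le> 0"
      using homogeneous_harmonic_eval_bound[OF r, of x] by simp
    have "r x = 0"
    proof (rule ccontr)
      assume "r x \<noteq> 0"
      then have "(norm (r x))\<^sup>2 * (fact k * gauss_moment TYPE('n) 0) > 0"
        using gauss_moment_pos[where 'n='n, of 0] by (intro mult_pos_pos) auto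
      with le show False by linarith
    qed
    then show ?thesis
      by (simp add: r_def P_def)
  qed
  with S that show ?thesis by blast
qed

section \<open>Polar coordinates and the zonal harmonics\<close>

lemma nn_integral_lborel_scale:
  fixes f :: "'a::euclidean_space \<Rightarrow> ennreal"
  assumes [measurable]: "f \<in> borel_measurable borel" and r: "r > 0"
  shows "(\<integral>\<^sup>+x. f x \<partial>lborel) = ennreal (r ^ DIM('a)) * (\<integral>\<^sup>+x. f (r *\<^sub>R x) \<partial>lborel)"
proof -
  have *: "lborel = density (distr lborel borel (\<lambda>x::'a. r *\<^sub>R x)) (\<lambda>_. ennreal (r ^ DIM('a)))"
    using lborel_affine[of r "0::'a"] r by simp
  show ?thesis
    by (subst *) (simp add: nn_integral_density nn_integral_distr nn_integral_cmult)
qed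

lemma nn_integral_cball_homogeneous:
  fixes G :: "'a::euclidean_space \<Rightarrow> ennreal"
  assumes [measurable]: "G \<in> borel_measurable borel"
    and hom: "\<And>c x. c > 0 \<Longrightarrow> G (c *\<^sub>R x) = G x" and r: "r > 0"
  shows "(\<integral>\<^sup>+x. G x * indicator (cball 0 r) x \<partial>lborel) =
    ennreal (r ^ DIM('a)) * (\<integral>\<^sup>+x. G x * indicator (cball 0 1) x \<partial>lborel)"
proof -
  have "indicator (cball 0 r) (r *\<^sub>R x) = (indicator (cball 0 1) x :: ennreal)" for x :: 'a
    using r by (auto simp: indicator_def)
  moreover have [measurable]: "cball (0::'a) r \<in> sets borel"
    by (simp add: borel_closed)
  have "(\<lambda>x. G x * indicator (cball 0 r) x) \<in> borel_measurable borel"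
    by measurable
  note nn_integral_lborel_scale[OF this r]
  ultimately show ?thesis
    by (simp add: hom r)
qed

text \<open>Integration in polar coordinates: both sides are integrals of \<open>\<phi>\<close> against measures on the
  line that agree on the half-lines, since the integral of a function of degree zero over a ball is
  proportional to the volume of the ball.\<close>

lemma nn_integral_polar:
  fixes G :: "'a::euclidean_space \<Rightarrow> ennreal" and \<phi> :: "real \<Rightarrow> ennreal"
  assumes [measurable]: "G \<in> borel_measurable borel" "\<phi> \<in> borel_measurable borel"
    and hom: "\<And>c x. c > 0 \<Longrightarrow> G (c *\<^sub>R x) = G x" and G1: "\<And>x. G x \<le> 1"
  shows "emeasure lborel (cball (0::'a) 1) * (\<integral>\<^sup>+x. \<phi> (norm x) * G x \<partial>lborel) =
    (\<integral>\<^sup>+x. G x * indicator (cball 0 1) x \<partial>lborel) * (\<integral>\<^sup>+x. \<phi> (norm (x :: 'a)) \<partial>lborel)"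
proof -
  define v where "v = emeasure lborel (cball (0::'a) 1)"
  define g where "g = (\<integral>\<^sup>+x. G x * indicator (cball 0 1) x \<partial>lborel)"
  define M where "M = density (distr (density lborel G) borel norm) (\<lambda>_. v)"
  define N where "N = density (distr lborel borel (norm :: 'a \<Rightarrow> real)) (\<lambda>_. g)"
  have v: "v < \<infinity>"
    unfolding v_def by (rule emeasure_lborel_cball_finite)
  have "g \<le> (\<integral>\<^sup>+x. indicator (cball (0::'a) 1) x \<partial>lborel)"
    unfolding g_def by (intro nn_integral_mono) (auto simp: indicator_def G1)
  then have g: "g < \<infinity>"
    using v by (simp add: v_def)
  have vim: "norm -` {..r} = cball (0::'a) r" for r
    by auto
  have M_eq: "emeasure M {..r} = v * (\<integral>\<^sup>+x. G x * indicator (cball 0 r) x \<partial>lborel)" for r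
    by (simp add: M_def emeasure_density_const emeasure_distr vim emeasure_density)
  have N_eq: "emeasure N {..r} = g * emeasure lborel (cball (0::'a) r)" for r
    by (simp add: N_def emeasure_density_const emeasure_distr vim)
  have zero: "(\<integral>\<^sup>+x. G x * indicator (cball 0 r) x \<partial>lborel) = 0 \<and>
      emeasure lborel (cball (0::'a) r) = 0" if "r \<le> 0" for r
  proof -
    have null: "emeasure lborel (cball (0::'a) r) = 0"
    proof (cases "r = 0")
      case False
      with that have "cball (0::'a) r = {}" by auto
      then show ?thesis by simp
    qed simp
    have "(\<integral>\<^sup>+x. G x * indicator (cball 0 r) x \<partial>lborel) \<le> (\<integral>\<^sup>+x. indicator (cball (0::'a) r) x \<partial>lborel)"
      by (intro nn_integral_mono) (auto simp: indicator_def G1)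
    with null show ?thesis by simp
  qed
  have "M = N"
  proof (rule measure_eqI_generator_eq[where E="range atMost" and \<Omega>=UNIV and A="\<lambda>i. {..real i}"])
    show "Int_stable (range (atMost :: real \<Rightarrow> real set))"
      by (auto simp: Int_stable_def)
    show "sets M = sigma_sets UNIV (range atMost)" "sets N = sigma_sets UNIV (range atMost)"
      by (simp_all add: M_def N_def borel_eq_atMost)
    show "(\<Union>i. {..real i}) = UNIV"
      by (auto simp: real_arch_simple)
    show "emeasure M {..real i} \<noteq> \<infinity>" for i
    proof -
      have "(\<integral>\<^sup>+x. G x * indicator (cball 0 (real i)) x \<partial>lborel) \<le>
          (\<integral>\<^sup>+x. indicator (cball (0::'a) (real i)) x \<partial>lborel)"
        by (intro nn_integral_mono) (auto simp: indicator_def G1)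
      also have "\<dots> < \<infinity>"
        using emeasure_lborel_cball_finite by simp
      finally show ?thesis
        using v by (auto simp: M_eq ennreal_mult_eq_top_iff)
    qed
    fix X :: "real set" assume "X \<in> range atMost"
    then obtain r where X: "X = {..r}" by auto
    show "emeasure M X = emeasure N X"
    proof (cases "r \<le> 0")
      case True
      then show ?thesis by (simp add: X M_eq N_eq zero)
    next
      case False
      then have r: "r > 0" by simp
      have "emeasure lborel (cball (0::'a) r) = ennreal (r ^ DIM('a)) * v"
        using nn_integral_cball_homogeneous[of "\<lambda>x::'a. 1" r] r by (simp add: v_def)
      then show ?thesis
        using nn_integral_cball_homogeneous[OF _ hom r]
        by (simp add: X M_eq N_eq g_def[symmetric] mult_ac)
    qed
  qed auto
  then have "(\<integral>\<^sup>+r. \<phi> r \<partial>M) = (\<integral>\<^sup>+r. \<phi> r \<partial>N)"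
    by simp
  moreover have "(\<integral>\<^sup>+r. \<phi> r \<partial>M) = v * (\<integral>\<^sup>+x. \<phi> (norm x) * G x \<partial>lborel)"
    by (simp add: M_def nn_integral_density nn_integral_distr nn_integral_cmult mult.commute)
  moreover have "(\<integral>\<^sup>+r. \<phi> r \<partial>N) = g * (\<integral>\<^sup>+x. \<phi> (norm (x :: 'a)) \<partial>lborel)"
    by (simp add: N_def nn_integral_density nn_integral_distr nn_integral_cmult)
  ultimately show ?thesis
    by (simp add: v_def g_def)
qed

lemma emeasure_cball_1: "emeasure lborel (cball (0::real^'n) 1) \<noteq> 0" "emeasure lborel (cball (0::real^'n) 1) \<noteq> \<infinity>"
proof -
  show "emeasure lborel (cball (0::real^'n) 1) \<noteq> \<infinity>"
    using emeasure_lborel_cball_finite[of "0::real^'n" 1] by simp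
  show "emeasure lborel (cball (0::real^'n) 1) \<noteq> 0"
    by (simp add: emeasure_cball unit_ball_vol_pos[THEN less_imp_neq, THEN not_sym])
qed

lemma sets_sphere_measure [simp, measurable_cong]: "sets sphere_measure = sets borel"
  by (simp add: sphere_measure_def)

lemma emeasure_sphere_measure:
  assumes [measurable]: "A \<in> sets borel"
  shows "emeasure (sphere_measure :: (real ^ 'n) measure) A =
    (\<integral>\<^sup>+x. indicator A (x /\<^sub>R norm x) * indicator (cball 0 1) x \<partial>lborel) /
      emeasure lborel (cball (0::real^'n) 1)"
proof -
  have "emeasure (sphere_measure :: (real ^ 'n) measure) A =
      (\<integral>\<^sup>+x. indicator A x \<partial>(sphere_measure :: (real ^ 'n) measure))"
    by simp
  also have "\<dots> = (\<integral>\<^sup>+x. indicator A (x /\<^sub>R norm x) \<partial>uniform_measure lborel (cball (0::real^'n) 1))"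
    unfolding sphere_measure_def by (subst nn_integral_distr) (auto simp: uniform_measure_def)
  also have "\<dots> = (\<integral>\<^sup>+x. indicator A (x /\<^sub>R norm x) * indicator (cball 0 1) x \<partial>lborel) /
      emeasure lborel (cball (0::real^'n) 1)"
    by (subst nn_integral_uniform_measure) auto
  finally show ?thesis .
qed

lemma AE_sphere_measure: "AE x in (sphere_measure :: (real ^ 'n) measure). norm x = 1"
proof -
  have "AE x in lborel. (x::real^'n) \<noteq> 0"
    by (rule AE_lborel_singleton)
  then have "AE x in lborel. x \<in> cball 0 1 \<longrightarrow> norm ((x::real^'n) /\<^sub>R norm x) = 1"
    by eventually_elim auto
  then have "AE x in uniform_measure lborel (cball 0 1). norm ((x::real^'n) /\<^sub>R norm x) = 1"
    by (intro AE_uniform_measureI) auto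
  then show ?thesis
    unfolding sphere_measure_def by (subst AE_distr_iff) (auto simp: uniform_measure_def)
qed

text \<open>The weight \<open>exp (- |x|\<^sup>2) |x|\<^sup>2\<^sup>k\<close>, radially projected to the sphere, is a multiple of the
  surface measure. Its factor \<open>|x|\<^sup>2\<^sup>k\<close> is the one by which the product of two homogeneous functions
  of degree \<open>k\<close> exceeds its restriction to the sphere.\<close>

lemma distr_gauss_sphere:
  "distr (density lborel (\<lambda>x::real^'n. ennreal (exp (- (norm x)\<^sup>2) * norm x ^ (2 * k)))) borel
     (\<lambda>x. x /\<^sub>R norm x) =
   density sphere_measure (\<lambda>_. ennreal (gauss_moment TYPE('n) k))"
  (is "?L = ?R")
proof (rule measure_eqI)
  show "sets ?L = sets ?R" by simp
  fix A assume "A \<in> sets ?L"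
  then have A [measurable]: "A \<in> sets borel" by simp
  define \<phi> where "\<phi> = (\<lambda>r::real. ennreal (exp (- r\<^sup>2) * r ^ (2 * k)))"
  define G where "G = (\<lambda>x::real^'n. indicator A (x /\<^sub>R norm x) :: ennreal)"
  define v where "v = emeasure lborel (cball (0::real^'n) 1)"
  have [measurable]: "\<phi> \<in> borel_measurable borel" "G \<in> borel_measurable borel"
    unfolding \<phi>_def G_def by measurable
  have mom: "(\<integral>\<^sup>+x. \<phi> (norm (x :: real ^ 'n)) \<partial>lborel) = ennreal (gauss_moment TYPE('n) k)"
  proof -
    have "integrable lborel (\<lambda>y::real^'n. exp (- (norm y)\<^sup>2) *\<^sub>R complex_of_real (norm y ^ (2 * k)))"
      by (intro integrable_gauss_integral polynomial_function_of_real real_polynomial_function_norm_power)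
    from integrable_norm[OF this]
    have "integrable lborel (\<lambda>y::real^'n. exp (- (norm y)\<^sup>2) * norm y ^ (2 * k))"
      by (simp add: norm_power)
    then show ?thesis
      unfolding \<phi>_def gauss_moment_def by (intro nn_integral_eq_integral) auto
  qed
  have "emeasure ?L A = (\<integral>\<^sup>+x. \<phi> (norm x) * G x \<partial>lborel)"
  proof -
    have "(\<lambda>x::real^'n. x /\<^sub>R norm x) -` A \<in> sets borel"
      by (rule measurable_sets_borel[OF _ A]) measurable
    then show ?thesis
      by (simp add: emeasure_distr emeasure_density \<phi>_def G_def indicator_def)
  qed
  moreover have "v * (\<integral>\<^sup>+x. \<phi> (norm x) * G x \<partial>lborel) =
      (\<integral>\<^sup>+x. G x * indicator (cball 0 1) x \<partial>lborel) * ennreal (gauss_moment TYPE('n) k)"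
    unfolding v_def mom[symmetric]
    by (rule nn_integral_polar)
       (auto simp: G_def indicator_def sgn_div_norm[symmetric] sgn_scaleR)
  moreover have "emeasure ?R A = ennreal (gauss_moment TYPE('n) k) *
      ((\<integral>\<^sup>+x. G x * indicator (cball 0 1) x \<partial>lborel) / v)"
    by (simp add: emeasure_density_const emeasure_sphere_measure G_def v_def)
  moreover have "v \<noteq> 0" "v \<noteq> \<infinity>"
    unfolding v_def by (rule emeasure_cball_1)+
  ultimately show "emeasure ?L A = emeasure ?R A"
    by (metis (no_types, lifting) ennreal_mult_divide_eq ennreal_times_divide infinity_ennreal_def mult.commute)
qed

lemma gauss_integral_sphere:
  fixes F :: "real ^ 'n \<Rightarrow> complex"
  assumes F: "polynomial_function F" and hom: "\<And>c x. F (c *\<^sub>R x) = of_real (c ^ (2 * k)) * F x"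
  shows "gauss_integral F = of_real (gauss_moment TYPE('n) k) * (\<integral>\<xi>. F \<xi> \<partial>sphere_measure)"
proof -
  have [measurable]: "F \<in> borel_measurable borel"
    by (rule borel_measurable_polynomial_function[OF F])
  have "of_real (gauss_moment TYPE('n) k) * (\<integral>\<xi>. F \<xi> \<partial>sphere_measure) =
      (\<integral>\<xi>. F \<xi> \<partial>density sphere_measure (\<lambda>_. ennreal (gauss_moment TYPE('n) k)))"
    using gauss_moment_pos[where 'n='n, of k]
    by (subst integral_density) (auto simp: scaleR_conv_of_real)
  also have "\<dots> = (\<integral>x. F (x /\<^sub>R norm x)
      \<partial>density lborel (\<lambda>x::real^'n. ennreal (exp (- (norm x)\<^sup>2) * norm x ^ (2 * k))))"
    unfolding distr_gauss_sphere[symmetric] by (subst integral_distr) auto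
  also have "\<dots> = (\<integral>x. (exp (- (norm x)\<^sup>2) * norm x ^ (2 * k)) *\<^sub>R F (x /\<^sub>R norm x) \<partial>lborel)"
    by (subst integral_density) auto
  also have "\<dots> = gauss_integral F"
    unfolding gauss_integral_def
  proof (rule integral_cong_AE)
    have "AE x in lborel. (x::real^'n) \<noteq> 0"
      by (rule AE_lborel_singleton)
    then show "AE x in lborel. (exp (- (norm x)\<^sup>2) * norm x ^ (2 * k)) *\<^sub>R F (x /\<^sub>R norm x) =
        exp (- (norm x)\<^sup>2) *\<^sub>R F x"
    proof eventually_elim
      case (elim x)
      then have "F x = of_real (norm x ^ (2 * k)) * F (x /\<^sub>R norm x)"
        using hom[of "norm x" "x /\<^sub>R norm x"] by simp
      then show ?case
        by (simp add: scaleR_conv_of_real)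
    qed
  qed measurable
  finally show ?thesis by simp
qed

lemma gauss_inner_sphere:
  fixes p q :: "real ^ 'n \<Rightarrow> complex"
  assumes p: "p \<in> homogeneous_harmonic_polynomials k" and q: "q \<in> homogeneous_harmonic_polynomials k"
  shows "gauss_inner p q = of_real (gauss_moment TYPE('n) k) *
    (\<integral>\<xi>. restrict p (sphere 0 1) \<xi> * cnj (restrict q (sphere 0 1) \<xi>) \<partial>sphere_measure)"
proof -
  note P = homogeneous_harmonic_polynomialsD[OF p] homogeneous_harmonic_polynomialsD[OF q]
  have poly: "polynomial_function (\<lambda>y. p y * cnj (q y))"
    by (intro polynomial_function_times polynomial_function_cnj P)
  have "gauss_inner p q = of_real (gauss_moment TYPE('n) k) * (\<integral>\<xi>. p \<xi> * cnj (q \<xi>) \<partial>sphere_measure)"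
    unfolding gauss_inner_def
    by (rule gauss_integral_sphere[OF poly]) (simp add: P mult_2 power_add)
  also have "(\<integral>\<xi>. p \<xi> * cnj (q \<xi>) \<partial>sphere_measure) =
      (\<integral>\<xi>. restrict p (sphere 0 1) \<xi> * cnj (restrict q (sphere 0 1) \<xi>) \<partial>sphere_measure)"
  proof (rule integral_cong_AE)
    have [measurable]: "p \<in> borel_measurable borel" "q \<in> borel_measurable borel"
      using P(1,4) by (auto intro: borel_measurable_polynomial_function)
    have [measurable]: "cnj \<in> borel_measurable borel"
      by (intro borel_measurable_continuous_onI continuous_intros)
    have [measurable]: "sphere (0::real^'n) 1 \<in> sets borel"
      by (simp add: borel_closed)
    show "(\<lambda>\<xi>. p \<xi> * cnj (q \<xi>)) \<in> borel_measurable sphere_measure"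
      by measurable
    show "(\<lambda>\<xi>. restrict p (sphere 0 1) \<xi> * cnj (restrict q (sphere 0 1) \<xi>)) \<in>
        borel_measurable sphere_measure"
      unfolding restrict_def by measurable
    show "AE \<xi> in sphere_measure. p \<xi> * cnj (q \<xi>) =
        restrict p (sphere 0 1) \<xi> * cnj (restrict q (sphere 0 1) \<xi>)"
      using AE_sphere_measure by eventually_elim simp
  qed
  finally show ?thesis .
qed

text \<open>Both existence and uniqueness of the zonal harmonic come from a complete family: the
  reproducing property prescribes the inner products with its members.\<close>

lemma zonal_harmonic_eq:
  fixes S :: "(real ^ 'n \<Rightarrow> complex) set"
  assumes S: "orthonormal_harmonics k S"
    and complete: "\<And>p x. p \<in> homogeneous_harmonic_polynomials k \<Longrightarrow>
      p x = (\<Sum>q\<in>S. gauss_inner p q * q x)"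
    and \<eta>: "norm \<eta> = 1"
  shows "zonal_harmonic k \<eta> =
    restrict (\<lambda>\<xi>. of_real (gauss_moment TYPE('n) k) * (\<Sum>q\<in>S. cnj (q \<eta>) * q \<xi>)) (sphere 0 1)"
proof -
  define \<kappa> where "\<kappa> = complex_of_real (gauss_moment TYPE('n) k)"
  have \<kappa>: "\<kappa> \<noteq> 0" "cnj \<kappa> = \<kappa>"
    using gauss_moment_pos[where 'n='n, of k] by (simp_all add: \<kappa>_def)
  have fin: "finite S" and hh: "\<And>q. q \<in> S \<Longrightarrow> q \<in> homogeneous_harmonic_polynomials k"
    using S by (auto simp: orthonormal_harmonics_def)
  note poly = homogeneous_harmonic_polynomialsD(1)
  define z where "z = (\<lambda>\<xi>. \<kappa> * (\<Sum>q\<in>S. cnj (q \<eta>) * q \<xi>))"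
  have z: "z \<in> homogeneous_harmonic_polynomials k"
    unfolding z_def by (intro homogeneous_harmonic_polynomials_cmult
        homogeneous_harmonic_polynomials_sum hh fin)
  show ?thesis
    unfolding zonal_harmonic_def \<kappa>_def[symmetric] z_def[symmetric]
  proof (rule the_equality)
    have "p \<eta> = (\<integral>\<xi>. p \<xi> * cnj (restrict z (sphere 0 1) \<xi>) \<partial>sphere_measure)"
      if p: "p \<in> spherical_harmonics k" for p
    proof -
      obtain p' where p': "p' \<in> homogeneous_harmonic_polynomials k" "p = restrict p' (sphere 0 1)"
        using p unfolding spherical_harmonics_def by blast
      have "cnj (gauss_inner p' z) = gauss_inner z p'"
        by (rule gauss_inner_commute[symmetric])
      also have "\<dots> = \<kappa> * gauss_inner (\<lambda>\<xi>. \<Sum>q\<in>S. cnj (q \<eta>) * q \<xi>) p'"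
        unfolding z_def by (rule gauss_inner_cmult_left)
      also have "gauss_inner (\<lambda>\<xi>. \<Sum>q\<in>S. cnj (q \<eta>) * q \<xi>) p' =
          (\<Sum>q\<in>S. gauss_inner (\<lambda>\<xi>. cnj (q \<eta>) * q \<xi>) p')"
        by (intro gauss_inner_sum_left polynomial_function_cmult poly[OF hh] poly[OF p'(1)])
      also have "\<dots> = (\<Sum>q\<in>S. cnj (q \<eta>) * cnj (gauss_inner p' q))"
        by (intro sum.cong refl) (simp add: gauss_inner_cmult_left gauss_inner_commute[of _ p'])
      also have "\<dots> = cnj (p' \<eta>)"
        by (subst complete[OF p'(1)]) (simp add: mult.commute)
      finally have "cnj (gauss_inner p' z) = cnj (\<kappa> * p' \<eta>)"
        by (simp add: \<kappa>)
      then have "gauss_inner p' z = \<kappa> * p' \<eta>"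
        by (simp only: complex_cnj_cancel_iff)
      then have "\<kappa> * p' \<eta> = gauss_inner p' z"
        by (rule sym)
      also have "\<dots> = \<kappa> * (\<integral>\<xi>. p \<xi> * cnj (restrict z (sphere 0 1) \<xi>) \<partial>sphere_measure)"
        unfolding p'(2) \<kappa>_def by (rule gauss_inner_sphere[OF p'(1) z])
      finally have "p' \<eta> = (\<integral>\<xi>. p \<xi> * cnj (restrict z (sphere 0 1) \<xi>) \<partial>sphere_measure)"
        using \<kappa>(1) by (simp only: mult_cancel_left) simp
      then show ?thesis
        using \<eta> by (simp only: p'(2) restrict_def) simp
    qed
    then show "restrict z (sphere 0 1) \<in> spherical_harmonics k \<and>
        (\<forall>p\<in>spherical_harmonics k. p \<eta> =
          (\<integral>\<xi>. p \<xi> * cnj (restrict z (sphere 0 1) \<xi>) \<partial>sphere_measure))"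
      using z by (auto simp: spherical_harmonics_def)
  next
    fix Z assume Z: "Z \<in> spherical_harmonics k \<and>
        (\<forall>p\<in>spherical_harmonics k. p \<eta> = (\<integral>\<xi>. p \<xi> * cnj (Z \<xi>) \<partial>sphere_measure))"
    then obtain w where w: "w \<in> homogeneous_harmonic_polynomials k" "Z = restrict w (sphere 0 1)"
      unfolding spherical_harmonics_def by blast
    have "gauss_inner w q = \<kappa> * cnj (q \<eta>)" if q: "q \<in> S" for q
    proof -
      have "restrict q (sphere 0 1) \<in> spherical_harmonics k"
        using hh[OF q] by (auto simp: spherical_harmonics_def)
      with Z have "restrict q (sphere 0 1) \<eta> =
          (\<integral>\<xi>. restrict q (sphere 0 1) \<xi> * cnj (Z \<xi>) \<partial>sphere_measure)"
        by blast
      then have "gauss_inner q w = \<kappa> * q \<eta>"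
        using \<eta> by (simp add: gauss_inner_sphere[OF hh[OF q] w(1)] w(2) \<kappa>_def)
      then show ?thesis
        using gauss_inner_commute[of w q] by (simp add: \<kappa>)
    qed
    then have "w \<xi> = z \<xi>" for \<xi>
      by (subst complete[OF w(1)]) (simp add: z_def sum_distrib_left mult.assoc)
    then have "w = z" by (rule ext)
    then show "Z = restrict z (sphere 0 1)"
      by (simp only: w(2))
  qed
qed

lemma solid_zonal_harmonic_eq:
  fixes S :: "(real ^ 'n \<Rightarrow> complex) set"
  assumes S: "orthonormal_harmonics k S"
    and complete: "\<And>p x. p \<in> homogeneous_harmonic_polynomials k \<Longrightarrow>
      p x = (\<Sum>q\<in>S. gauss_inner p q * q x)"
  shows "solid_zonal_harmonic k x y =
    of_real (gauss_moment TYPE('n) k) * (\<Sum>q\<in>S. cnj (q y) * q x)"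
proof -
  have hh: "\<And>q. q \<in> S \<Longrightarrow> q \<in> homogeneous_harmonic_polynomials k"
    using S by (auto simp: orthonormal_harmonics_def)
  have scale: "q z = of_real (norm z ^ k) * q (z /\<^sub>R norm z)" if "q \<in> S" "z \<noteq> 0" for q z
    using homogeneous_harmonic_polynomialsD(2)[OF hh[OF that(1)], of "norm z" "z /\<^sub>R norm z"] that(2)
    by simp
  consider "k = 0" | "k \<noteq> 0" "x = 0 \<or> y = 0" | "k \<noteq> 0" "x \<noteq> 0" "y \<noteq> 0"
    by blast
  then show ?thesis
  proof cases
    case 1
    \<comment> \<open>In degree zero the value is \<open>1\<close> by definition; the constant function is reproduced.\<close>
    have one: "(\<lambda>x::real^'n. 1) \<in> homogeneous_harmonic_polynomials k"
      using 1 by (simp add: homogeneous_harmonic_polynomials_def laplacian_def partial_deriv_const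
          partial_deriv_def)
    have const: "q u = q y" if "q \<in> S" for q u
      using homogeneous_harmonic_polynomialsD(2)[OF hh[OF that], of 0] 1
      by (metis mult_1 of_real_1 power_0 scaleR_zero_left)
    have "gauss_inner (\<lambda>x. 1) q = of_real (gauss_moment TYPE('n) k) * cnj (q y)" if "q \<in> S" for q
    proof -
      have "(\<lambda>u. 1 * cnj (q u)) = (\<lambda>u. cnj (q y))"
        using const[OF that] by (metis mult_1)
      then show ?thesis
        by (simp add: gauss_inner_def gauss_integral_const 1)
    qed
    then have "1 = of_real (gauss_moment TYPE('n) k) * (\<Sum>q\<in>S. cnj (q y) * q x)"
      by (subst complete[OF one, of x]) (simp add: sum_distrib_left mult.assoc)
    then show ?thesis
      by (simp add: solid_zonal_harmonic_def 1)
  next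
    case 2
    have "q 0 = 0" if "q \<in> S" for q
      using homogeneous_harmonic_polynomialsD(2)[OF hh[OF that], of 0 0] 2(1)
      by (auto simp: power_0_left)
    then have "(\<Sum>q\<in>S. cnj (q y) * q x) = 0"
      using 2(2) by (intro sum.neutral) auto
    then show ?thesis
      using 2 by (simp add: solid_zonal_harmonic_def)
  next
    case 3
    have x1: "norm (x /\<^sub>R norm x) = 1" and y1: "norm (y /\<^sub>R norm y) = 1"
      using 3 by auto
    have "(\<Sum>q\<in>S. cnj (q y) * q x) = of_real (norm x ^ k * norm y ^ k) *
        (\<Sum>q\<in>S. cnj (q (y /\<^sub>R norm y)) * q (x /\<^sub>R norm x))"
      unfolding sum_distrib_left
    proof (rule sum.cong[OF refl])
      fix q assume "q \<in> S"
      then show "cnj (q y) * q x = of_real (norm x ^ k * norm y ^ k) *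
          (cnj (q (y /\<^sub>R norm y)) * q (x /\<^sub>R norm x))"
        by (subst scale[of q x], simp, simp add: 3, subst scale[of q y]) (simp_all add: 3)
    qed
    then show ?thesis
      using 3 x1 by (simp add: solid_zonal_harmonic_def zonal_harmonic_eq[OF S complete y1])
  qed
qed

text \<open>The Cauchy--Schwarz inequality for the sum over a complete family, together with Bessel's
  inequality at \<open>x\<close> and at \<open>y\<close>. The Pochhammer symbol on the right-hand side is the one by which
  the kernel divides.\<close>

lemma solid_zonal_harmonic_bound:
  fixes x y :: "real ^ 'n"
  shows "norm (solid_zonal_harmonic k x y) * fact k \<le> pochhammer (real CARD('n) / 2) k *
    (sqrt 2 ^ CARD('n) * (2 * exp 1 * (norm x * norm y)) ^ k)"
proof -
  obtain S :: "(real ^ 'n \<Rightarrow> complex) set" where S: "orthonormal_harmonics k S"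
    and complete: "\<And>p x. p \<in> homogeneous_harmonic_polynomials k \<Longrightarrow>
      p x = (\<Sum>q\<in>S. gauss_inner p q * q x)"
    using orthonormal_harmonics_complete by blast
  define m where "m = gauss_moment TYPE('n) 0"
  have m: "m > 0"
    unfolding m_def by (rule gauss_moment_pos)
  define D where "D = (2 * exp 1) ^ k * sqrt 2 ^ CARD('n) / (fact k * m)"
  have D: "D \<ge> 0" using m by (simp add: D_def)
  have bessel: "L2_set (\<lambda>q. norm (q z)) S \<le> sqrt D * norm z ^ k" for z
  proof -
    have "(\<Sum>q\<in>S. (norm (q z))\<^sup>2) \<le> D * norm z ^ (2 * k)"
      using orthonormal_harmonics_bessel[OF S, of z] m by (simp add: D_def m_def[symmetric] field_simps)
    then have "L2_set (\<lambda>q. norm (q z)) S \<le> sqrt (D * norm z ^ (2 * k))"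
      unfolding L2_set_def by (rule real_sqrt_le_mono)
    also have "\<dots> = sqrt D * norm z ^ k"
      by (simp add: real_sqrt_mult mult.commute[of 2 k] power_mult real_sqrt_unique)
    finally show ?thesis .
  qed
  have "norm (\<Sum>q\<in>S. cnj (q y) * q x) \<le> (\<Sum>q\<in>S. \<bar>norm (q y)\<bar> * \<bar>norm (q x)\<bar>)"
    by (rule order_trans[OF norm_sum]) (simp add: norm_mult)
  also have "\<dots> \<le> L2_set (\<lambda>q. norm (q y)) S * L2_set (\<lambda>q. norm (q x)) S"
    by (rule L2_set_mult_ineq)
  also have "\<dots> \<le> (sqrt D * norm y ^ k) * (sqrt D * norm x ^ k)"
    using D by (intro mult_mono bessel) auto
  also have "\<dots> = D * (norm x * norm y) ^ k"
    using D by (simp add: power_mult_distrib mult.left_commute mult.commute)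
  finally have *: "norm (\<Sum>q\<in>S. cnj (q y) * q x) \<le> D * (norm x * norm y) ^ k" .
  have "norm (solid_zonal_harmonic k x y) = gauss_moment TYPE('n) k * norm (\<Sum>q\<in>S. cnj (q y) * q x)"
    using gauss_moment_pos[where 'n='n, of k]
    by (simp add: solid_zonal_harmonic_eq[OF S complete] norm_mult)
  also have "\<dots> \<le> gauss_moment TYPE('n) k * (D * (norm x * norm y) ^ k)"
    using gauss_moment_pos[where 'n='n, of k] by (intro mult_left_mono *) simp
  finally have "norm (solid_zonal_harmonic k x y) * fact k \<le>
      gauss_moment TYPE('n) k * (D * (norm x * norm y) ^ k) * fact k"
    by (rule mult_right_mono) simp
  also have "\<dots> = pochhammer (real CARD('n) / 2) k *
      (sqrt 2 ^ CARD('n) * (2 * exp 1 * (norm x * norm y)) ^ k)"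
    using m by (simp add: gauss_moment_pochhammer[of k] m_def[symmetric] D_def power_mult_distrib)
  finally show ?thesis .
qed

section \<open>The action of the projection on Gaussian multiples of harmonic polynomials\<close>

text \<open>The default value \<open>0\<close> of the Bochner integral makes the first equation hold without
  integrability.\<close>

lemma
  fixes f :: "real ^ 'n \<Rightarrow> 'b::{banach, second_countable_topology}"
  assumes [measurable]: "f \<in> borel_measurable borel"
  shows integral_gauss_measure: "(\<integral>y. f y \<partial>gauss_measure \<alpha>) =
      ((pi * \<alpha>) powr (- real CARD('n) / 2)) *\<^sub>R (\<integral>y. exp (- (norm y)\<^sup>2 / \<alpha>) *\<^sub>R f y \<partial>lborel)"
    and integrable_gauss_measure: "integrable lborel (\<lambda>y. exp (- (norm y)\<^sup>2 / \<alpha>) *\<^sub>R f y) \<Longrightarrow>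
      integrable (gauss_measure \<alpha>) f"
proof -
  show "(\<integral>y. f y \<partial>gauss_measure \<alpha>) =
      ((pi * \<alpha>) powr (- real CARD('n) / 2)) *\<^sub>R (\<integral>y. exp (- (norm y)\<^sup>2 / \<alpha>) *\<^sub>R f y \<partial>lborel)"
    unfolding gauss_measure_def
    by (subst integral_density) (auto simp flip: scaleR_scaleR)
  assume "integrable lborel (\<lambda>y. exp (- (norm y)\<^sup>2 / \<alpha>) *\<^sub>R f y)"
  from integrable_scaleR_right[OF this, of "(pi * \<alpha>) powr (- real CARD('n) / 2)"]
  show "integrable (gauss_measure \<alpha>) f"
    unfolding gauss_measure_def by (subst integrable_density) auto
qed

lemma sets_gauss_measure [simp, measurable_cong]: "sets (gauss_measure \<alpha>) = sets borel"
  by (simp add: gauss_measure_def)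

lemma gauss_inner_rescaled:
  fixes p q :: "real ^ 'n \<Rightarrow> complex"
  assumes p: "p \<in> homogeneous_harmonic_polynomials m"
    and q: "q \<in> homogeneous_harmonic_polynomials k" and r: "r > 0"
  shows "(\<integral>y. exp (- (norm y)\<^sup>2 / r\<^sup>2) *\<^sub>R (p y * cnj (q y)) \<partial>lborel) =
    of_real (r ^ (CARD('n) + m + k)) * gauss_inner p q"
proof -
  note P = homogeneous_harmonic_polynomialsD[OF p] homogeneous_harmonic_polynomialsD[OF q]
  have "polynomial_function (\<lambda>y. p y * cnj (q y))"
    by (intro polynomial_function_times polynomial_function_cnj P)
  then have [measurable]: "(\<lambda>y. p y * cnj (q y)) \<in> borel_measurable borel"
    by (rule borel_measurable_polynomial_function)
  have "(\<integral>y. exp (- (norm y)\<^sup>2 / r\<^sup>2) *\<^sub>R (p y * cnj (q y)) \<partial>lborel) =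
      r ^ CARD('n) *\<^sub>R (\<integral>y. exp (- (norm (r *\<^sub>R y))\<^sup>2 / r\<^sup>2) *\<^sub>R
        (p (r *\<^sub>R y) * cnj (q (r *\<^sub>R y))) \<partial>lborel)"
    by (subst integral_lborel_scale[OF _ r]) auto
  also have "(\<lambda>y. exp (- (norm (r *\<^sub>R y))\<^sup>2 / r\<^sup>2) *\<^sub>R (p (r *\<^sub>R y) * cnj (q (r *\<^sub>R y)))) =
      (\<lambda>y. of_real (r ^ (m + k)) * (exp (- (norm y)\<^sup>2) *\<^sub>R (p y * cnj (q y))))"
    using r by (auto simp: P power_mult_distrib power_add)
  finally show ?thesis
    by (simp add: gauss_inner_def gauss_integral_def scaleR_conv_of_real power_add)
qed

lemma harmonic_Fock_kernel_term_bound: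
  fixes x y :: "real ^ 'n"
  assumes "\<alpha> > 0"
  shows "norm (solid_zonal_harmonic k x y / of_real (\<alpha> ^ k * pochhammer (real CARD('n) / 2) k)) \<le>
    sqrt 2 ^ CARD('n) * ((2 * exp 1 * (norm x * norm y) / \<alpha>) ^ k /\<^sub>R fact k)"
proof -
  have "pochhammer (real CARD('n) / 2) k > 0"
    by (intro pochhammer_pos) auto
  then show ?thesis
    using solid_zonal_harmonic_bound[of k x y] assms
    by (simp add: norm_divide norm_mult norm_power field_simps power_divide)
qed

text \<open>On a Gaussian multiple of a harmonic polynomial \<open>p\<close> of degree \<open>m\<close> all terms of the kernel
  but the one of degree \<open>m\<close> integrate to zero, and that one reproduces \<open>p\<close>.\<close>

lemma harmonic_Fock_projection_term:
  fixes p :: "real ^ 'n \<Rightarrow> complex"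
  assumes p: "p \<in> homogeneous_harmonic_polynomials m" and r: "r > 0"
  shows "(\<integral>y. exp (- (norm y)\<^sup>2 / r\<^sup>2) *\<^sub>R
      (solid_zonal_harmonic k x y / of_real (\<alpha> ^ k * pochhammer (real CARD('n) / 2) k) * p y) \<partial>lborel) =
    (if k = m then of_real (gauss_moment TYPE('n) 0 * r ^ CARD('n) * (r\<^sup>2 / \<alpha>) ^ m) * p x else 0)"
proof -
  obtain S :: "(real ^ 'n \<Rightarrow> complex) set" where S: "orthonormal_harmonics k S"
    and complete: "\<And>p x. p \<in> homogeneous_harmonic_polynomials k \<Longrightarrow>
      p x = (\<Sum>q\<in>S. gauss_inner p q * q x)"
    using orthonormal_harmonics_complete by blast
  have hh: "\<And>q. q \<in> S \<Longrightarrow> q \<in> homogeneous_harmonic_polynomials k"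
    using S by (auto simp: orthonormal_harmonics_def)
  define A where "A = complex_of_real (\<alpha> ^ k * pochhammer (real CARD('n) / 2) k)"
  define \<kappa> where "\<kappa> = complex_of_real (gauss_moment TYPE('n) k)"
  have \<kappa>A: "\<kappa> / A = of_real (gauss_moment TYPE('n) 0 / \<alpha> ^ k)"
  proof -
    have "pochhammer (real CARD('n) / 2) k > 0"
      by (intro pochhammer_pos) auto
    then show ?thesis
      unfolding \<kappa>_def A_def of_real_divide[symmetric] by (simp add: gauss_moment_pochhammer[of k])
  qed
  have int: "integrable lborel (\<lambda>y. exp (- (norm y)\<^sup>2 / r\<^sup>2) *\<^sub>R (p y * cnj (q y)))" if "q \<in> S" for q
  proof -
    have "polynomial_function (\<lambda>y. p y * cnj (q y))"
      by (intro polynomial_function_times polynomial_function_cnj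
          homogeneous_harmonic_polynomialsD(1)[OF p] homogeneous_harmonic_polynomialsD(1)[OF hh[OF that]])
    from integrable_gauss_polynomial[OF this, of "1 / r\<^sup>2"] r show ?thesis
      by simp
  qed
  have "exp (- (norm y)\<^sup>2 / r\<^sup>2) *\<^sub>R (solid_zonal_harmonic k x y / A * p y) =
      (\<Sum>q\<in>S. (\<kappa> / A * q x) * (exp (- (norm y)\<^sup>2 / r\<^sup>2) *\<^sub>R (p y * cnj (q y))))" for y
    by (simp add: solid_zonal_harmonic_eq[OF S complete] \<kappa>_def sum_distrib_left sum_distrib_right
        sum_divide_distrib scaleR_conv_of_real mult_ac)
  then have "(\<integral>y. exp (- (norm y)\<^sup>2 / r\<^sup>2) *\<^sub>R (solid_zonal_harmonic k x y / A * p y) \<partial>lborel) =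
      (\<integral>y. (\<Sum>q\<in>S. (\<kappa> / A * q x) * (exp (- (norm y)\<^sup>2 / r\<^sup>2) *\<^sub>R (p y * cnj (q y)))) \<partial>lborel)"
    by (simp only:)
  also have "\<dots> = (\<Sum>q\<in>S. \<integral>y. (\<kappa> / A * q x) * (exp (- (norm y)\<^sup>2 / r\<^sup>2) *\<^sub>R (p y * cnj (q y))) \<partial>lborel)"
    by (rule Bochner_Integration.integral_sum) (intro integrable_mult_right int)
  also have "\<dots> = (\<Sum>q\<in>S. (\<kappa> / A * q x) * (\<integral>y. exp (- (norm y)\<^sup>2 / r\<^sup>2) *\<^sub>R (p y * cnj (q y)) \<partial>lborel))"
    by (intro sum.cong refl Bochner_Integration.integral_mult_right int)
  also have "\<dots> = (\<Sum>q\<in>S. (\<kappa> / A * q x) * (of_real (r ^ (CARD('n) + m + k)) * gauss_inner p q))"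
    by (intro sum.cong refl) (simp only: gauss_inner_rescaled[OF p hh r])
  also have "\<dots> = \<kappa> / A * of_real (r ^ (CARD('n) + m + k)) * (\<Sum>q\<in>S. gauss_inner p q * q x)"
    unfolding sum_distrib_left by (intro sum.cong refl) (simp add: mult_ac)
  also have "\<dots> = (if k = m then of_real (gauss_moment TYPE('n) 0 * r ^ CARD('n) * (r\<^sup>2 / \<alpha>) ^ m) * p x
      else 0)"
  proof (cases "k = m")
    case True
    have "gauss_moment TYPE('n) 0 / \<alpha> ^ m * r ^ (CARD('n) + m + m) =
        gauss_moment TYPE('n) 0 * r ^ CARD('n) * (r\<^sup>2 / \<alpha>) ^ m"
      by (simp add: power_add power_divide power2_eq_square power_mult_distrib)
    moreover have "(\<Sum>q\<in>S. gauss_inner p q * q x) = p x"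
      using complete[of p x] p True by simp
    ultimately show ?thesis
      unfolding \<kappa>A using True by (simp only: of_real_mult[symmetric]) simp
  next
    case False
    then have "gauss_inner p q = 0" if "q \<in> S" for q
      unfolding gauss_inner_def using homogeneous_harmonic_orthogonal[OF p hh[OF that]] by simp
    then show ?thesis
      using False by simp
  qed
  finally show ?thesis
    by (simp only: A_def)
qed

text \<open>The Gaussian factor of the measure and that of the function combine to
  \<open>exp (- |y|\<^sup>2 / r\<^sup>2)\<close>. The partial sums of the kernel are dominated by \<open>exp (b |y|)\<close> up to a
  constant, and from degree \<open>m\<close> on their integrals no longer change.\<close>

lemma harmonic_Fock_projection_gaussian:
  fixes p :: "real ^ 'n \<Rightarrow> complex"
  assumes p: "p \<in> homogeneous_harmonic_polynomials m" and \<alpha>: "\<alpha> > 0" and t: "1 + \<alpha> * t > 0"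
  shows "harmonic_Fock_projection \<alpha> (\<lambda>y. exp (- (t * (norm y)\<^sup>2)) *\<^sub>R p y) x =
    of_real ((pi * \<alpha>) powr (- real CARD('n) / 2) * gauss_moment TYPE('n) 0 *
      sqrt (\<alpha> / (1 + \<alpha> * t)) ^ CARD('n) * (1 / (1 + \<alpha> * t)) ^ m) * p x"
proof -
  define r where "r = sqrt (\<alpha> / (1 + \<alpha> * t))"
  have r: "r > 0" and r2: "r\<^sup>2 = \<alpha> / (1 + \<alpha> * t)"
    using \<alpha> t by (simp_all add: r_def)
  have weight: "exp (- (norm y)\<^sup>2 / \<alpha>) * exp (- (t * (norm y)\<^sup>2)) = exp (- (norm y)\<^sup>2 / r\<^sup>2)" for y :: "real ^ 'n"
    using \<alpha> t by (simp add: r2 exp_add[symmetric] field_simps)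
  define a where "a = (\<lambda>k y. solid_zonal_harmonic k x y /
      complex_of_real (\<alpha> ^ k * pochhammer (real CARD('n) / 2) k))"
  define u where "u = (\<lambda>N y. exp (- (norm y)\<^sup>2 / r\<^sup>2) *\<^sub>R ((\<Sum>k<N. a k y) * p y))"
  define b where "b = 2 * exp 1 * norm x / \<alpha>"
  define w where "w = (\<lambda>y. exp (- (1 / r\<^sup>2 * (norm y)\<^sup>2)) *\<^sub>R (sqrt 2 ^ CARD('n) * exp (b * norm y) * norm (p y)))"
  obtain C d where C: "C \<ge> 0" "d \<ge> 0" "\<And>y. norm (p y) \<le> C * exp (d * norm y)"
    using polynomial_function_exp_bound[OF homogeneous_harmonic_polynomialsD(1)[OF p]] by blast
  have [measurable]: "p \<in> borel_measurable borel"
    by (rule borel_measurable_polynomial_function[OF homogeneous_harmonic_polynomialsD(1)[OF p]])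
  have a_meas [measurable]: "a k \<in> borel_measurable borel" for k
  proof -
    obtain S :: "(real ^ 'n \<Rightarrow> complex) set" where S: "orthonormal_harmonics k S"
      and complete: "\<And>p x. p \<in> homogeneous_harmonic_polynomials k \<Longrightarrow>
        p x = (\<Sum>q\<in>S. gauss_inner p q * q x)"
      using orthonormal_harmonics_complete by blast
    have "q \<in> borel_measurable borel" if "q \<in> S" for q
      using S that by (auto simp: orthonormal_harmonics_def
          dest!: subsetD homogeneous_harmonic_polynomialsD(1) intro: borel_measurable_polynomial_function)
    then have "(\<lambda>y. \<Sum>q\<in>S. cnj (q y) * q x) \<in> borel_measurable borel"
      by (intro borel_measurable_sum borel_measurable_times)
         (auto intro: borel_measurable_continuous_on[where f=cnj] continuous_intros)
    then have "(\<lambda>y. complex_of_real (gauss_moment TYPE('n) k) * (\<Sum>q\<in>S. cnj (q y) * q x) /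
        complex_of_real (\<alpha> ^ k * pochhammer (real CARD('n) / 2) k)) \<in> borel_measurable borel"
      by (intro borel_measurable_divide borel_measurable_times borel_measurable_const)
    moreover have "a k = (\<lambda>y. complex_of_real (gauss_moment TYPE('n) k) * (\<Sum>q\<in>S. cnj (q y) * q x) /
        complex_of_real (\<alpha> ^ k * pochhammer (real CARD('n) / 2) k))"
      unfolding a_def by (intro ext arg_cong2[where f=divide] refl solid_zonal_harmonic_eq[OF S complete])
    ultimately show ?thesis by simp
  qed
  have a_bound: "norm (a k y) \<le> sqrt 2 ^ CARD('n) * ((b * norm y) ^ k /\<^sub>R fact k)" for k y
    using harmonic_Fock_kernel_term_bound[OF \<alpha>, of k x y] by (simp add: a_def b_def mult_ac)
  have b_nonneg: "b * norm y \<ge> 0" for y :: "real ^ 'n"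
    using \<alpha> by (simp add: b_def)
  have exp_sums: "(\<lambda>k. sqrt 2 ^ CARD('n) * ((b * norm y) ^ k /\<^sub>R fact k)) sums
      (sqrt 2 ^ CARD('n) * exp (b * norm y))" for y :: "real ^ 'n"
    by (intro sums_mult exp_converges)
  have a_sums: "(\<lambda>k. a k y) sums harmonic_Fock_kernel \<alpha> x y" for y
  proof -
    have "summable (\<lambda>k. a k y)"
      by (rule summable_comparison_test[OF _ sums_summable[OF exp_sums]]) (use a_bound in auto)
    then show ?thesis
      by (simp add: harmonic_Fock_kernel_def a_def summable_sums)
  qed
  have H_meas [measurable]: "harmonic_Fock_kernel \<alpha> x \<in> borel_measurable borel"
  proof (rule borel_measurable_LIMSEQ_metric)
    show "(\<lambda>y. \<Sum>k<N. a k y) \<in> borel_measurable borel" for N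
      by measurable
    show "(\<lambda>N. \<Sum>k<N. a k y) \<longlonglongrightarrow> harmonic_Fock_kernel \<alpha> x y" for y
      using a_sums[of y] by (simp only: sums_def)
  qed
  have "(\<lambda>N. \<integral>y. u N y \<partial>lborel) \<longlonglongrightarrow>
      (\<integral>y. exp (- (norm y)\<^sup>2 / r\<^sup>2) *\<^sub>R (harmonic_Fock_kernel \<alpha> x y * p y) \<partial>lborel)"
  proof (rule integral_dominated_convergence[where w=w])
    show "integrable lborel w"
      unfolding w_def
    proof (rule integrable_gauss)
      fix y :: "real ^ 'n"
      have "norm (sqrt 2 ^ CARD('n) * exp (b * norm y) * norm (p y)) \<le>
          sqrt 2 ^ CARD('n) * exp (b * norm y) * (C * exp (d * norm y))"
        using C(3)[of y] by (simp add: abs_mult mult_left_mono)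
      also have "\<dots> = (sqrt 2 ^ CARD('n) * C) * exp ((b + d) * norm y)"
        by (simp add: distrib_right exp_add)
      finally show "norm (sqrt 2 ^ CARD('n) * exp (b * norm y) * norm (p y)) \<le>
          (sqrt 2 ^ CARD('n) * C) * exp ((b + d) * norm y)" .
    qed (use r in auto)
    show "AE y in lborel. (\<lambda>N. u N y) \<longlonglongrightarrow>
        exp (- (norm y)\<^sup>2 / r\<^sup>2) *\<^sub>R (harmonic_Fock_kernel \<alpha> x y * p y)"
      using a_sums unfolding u_def sums_def by (intro AE_I2 tendsto_intros) auto
    fix N
    have "norm (\<Sum>k<N. a k y) \<le> sqrt 2 ^ CARD('n) * exp (b * norm y)" for y
    proof -
      have "norm (\<Sum>k<N. a k y) \<le> (\<Sum>k<N. sqrt 2 ^ CARD('n) * ((b * norm y) ^ k /\<^sub>R fact k))"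
        by (intro sum_norm_le a_bound)
      also have "\<dots> \<le> sqrt 2 ^ CARD('n) * exp (b * norm y)"
        unfolding sums_unique[OF exp_sums]
        by (intro sum_le_suminf sums_summable[OF exp_sums]) (use b_nonneg in auto)
      finally show ?thesis .
    qed
    then have "norm ((\<Sum>k<N. a k y) * p y) \<le> sqrt 2 ^ CARD('n) * exp (b * norm y) * norm (p y)" for y
      unfolding norm_mult by (rule mult_right_mono) simp
    then show "AE y in lborel. norm (u N y) \<le> w y"
      unfolding u_def w_def norm_scaleR by (intro AE_I2) (simp add: mult.assoc)
  qed (simp_all add: u_def)
  moreover have "(\<integral>y. u N y \<partial>lborel) =
      of_real (gauss_moment TYPE('n) 0 * r ^ CARD('n) * (r\<^sup>2 / \<alpha>) ^ m) * p x" if "N > m" for N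
  proof -
    have "integrable lborel (\<lambda>y. exp (- (norm y)\<^sup>2 / r\<^sup>2) *\<^sub>R (a k y * p y))" for k
    proof -
      have "integrable lborel (\<lambda>y. exp (- (1 / r\<^sup>2 * (norm y)\<^sup>2)) *\<^sub>R (a k y * p y))"
      proof (rule integrable_gauss)
        fix y :: "real ^ 'n"
        have "norm (a k y) \<le> sqrt 2 ^ CARD('n) * exp (b * norm y)"
        proof -
          have "norm (a k y) \<le> (\<Sum>j\<in>{k}. sqrt 2 ^ CARD('n) * ((b * norm y) ^ j /\<^sub>R fact j))"
            using a_bound[of k y] by simp
          also have "\<dots> \<le> sqrt 2 ^ CARD('n) * exp (b * norm y)"
            unfolding sums_unique[OF exp_sums]
            by (intro sum_le_suminf sums_summable[OF exp_sums]) (use b_nonneg in auto)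
          finally show ?thesis .
        qed
        then have "norm (a k y * p y) \<le> (sqrt 2 ^ CARD('n) * exp (b * norm y)) * (C * exp (d * norm y))"
          unfolding norm_mult using C by (intro mult_mono) auto
        also have "\<dots> = (sqrt 2 ^ CARD('n) * C) * exp ((b + d) * norm y)"
          by (simp add: distrib_right exp_add)
        finally show "norm (a k y * p y) \<le> (sqrt 2 ^ CARD('n) * C) * exp ((b + d) * norm y)" .
      qed (use r in auto)
      then show ?thesis by simp
    qed
    then have "(\<integral>y. u N y \<partial>lborel) =
        (\<Sum>k<N. \<integral>y. exp (- (norm y)\<^sup>2 / r\<^sup>2) *\<^sub>R (a k y * p y) \<partial>lborel)"
      by (simp add: u_def sum_distrib_right scaleR_sum_right)
    also have "\<dots> = (\<Sum>k<N. if k = m then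
        of_real (gauss_moment TYPE('n) 0 * r ^ CARD('n) * (r\<^sup>2 / \<alpha>) ^ m) * p x else 0)"
      unfolding a_def by (intro sum.cong refl harmonic_Fock_projection_term p r)
    finally show ?thesis
      using that by simp
  qed
  then have "(\<lambda>N. \<integral>y. u N y \<partial>lborel) \<longlonglongrightarrow>
      of_real (gauss_moment TYPE('n) 0 * r ^ CARD('n) * (r\<^sup>2 / \<alpha>) ^ m) * p x"
    by (intro tendsto_eventually eventually_sequentiallyI[of "Suc m"]) auto
  ultimately have lim: "(\<integral>y. exp (- (norm y)\<^sup>2 / r\<^sup>2) *\<^sub>R (harmonic_Fock_kernel \<alpha> x y * p y) \<partial>lborel) =
      of_real (gauss_moment TYPE('n) 0 * r ^ CARD('n) * (r\<^sup>2 / \<alpha>) ^ m) * p x"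
    by (rule LIMSEQ_unique)
  have "harmonic_Fock_projection \<alpha> (\<lambda>y. exp (- (t * (norm y)\<^sup>2)) *\<^sub>R p y) x =
      (pi * \<alpha>) powr (- real CARD('n) / 2) *\<^sub>R (\<integral>y. exp (- (norm y)\<^sup>2 / \<alpha>) *\<^sub>R
        (harmonic_Fock_kernel \<alpha> x y * (exp (- (t * (norm y)\<^sup>2)) *\<^sub>R p y)) \<partial>lborel)"
    unfolding harmonic_Fock_projection_def by (subst integral_gauss_measure) auto
  also have "(\<lambda>y. exp (- (norm y)\<^sup>2 / \<alpha>) *\<^sub>R
        (harmonic_Fock_kernel \<alpha> x y * (exp (- (t * (norm y)\<^sup>2)) *\<^sub>R p y))) =
      (\<lambda>y. exp (- (norm y)\<^sup>2 / r\<^sup>2) *\<^sub>R (harmonic_Fock_kernel \<alpha> x y * p y))"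
    by (simp only: mult_scaleR_right scaleR_scaleR weight)
  also have "(pi * \<alpha>) powr (- real CARD('n) / 2) *\<^sub>R
      (\<integral>y. exp (- (norm y)\<^sup>2 / r\<^sup>2) *\<^sub>R (harmonic_Fock_kernel \<alpha> x y * p y) \<partial>lborel) =
      of_real ((pi * \<alpha>) powr (- real CARD('n) / 2)) *
        (of_real (gauss_moment TYPE('n) 0 * r ^ CARD('n) * (1 / (1 + \<alpha> * t)) ^ m) * p x)"
  proof -
    have "r\<^sup>2 / \<alpha> = 1 / (1 + \<alpha> * t)"
      using \<alpha> by (simp add: r2)
    then show ?thesis
      unfolding lim by (simp only: scaleR_conv_of_real)
  qed
  finally show ?thesis
    unfolding r_def[symmetric] by (simp only: of_real_mult mult.assoc)
qed

section \<open>Powers of a complex linear form as test functions\<close>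

text \<open>The gradient of \<open>l\<close> is isotropic: the squares of its components sum to \<open>1 + i\<^sup>2 = 0\<close>.\<close>

lemma power_harmonic:
  assumes "CARD('n::finite) \<ge> 2"
  obtains l :: "real ^ 'n \<Rightarrow> complex" and x0 where
    "\<And>m. (\<lambda>y. l y ^ m) \<in> homogeneous_harmonic_polynomials m" "l x0 \<noteq> 0"
proof -
  have "\<not> card (Basis :: (real ^ 'n) set) \<le> Suc 0"
    using assms by simp
  then obtain a b :: "real ^ 'n" where ab: "a \<in> Basis" "b \<in> Basis" "a \<noteq> b"
    unfolding card_le_Suc0_iff_eq[OF finite_Basis] by blast
  define l where "l = (\<lambda>y. complex_of_real (y \<bullet> a) + \<i> * complex_of_real (y \<bullet> b))"
  have poly: "polynomial_function l"
    unfolding l_def by (intro polynomial_function_add polynomial_function_times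
        polynomial_function_const polynomial_function_of_real real_polynomial_function_inner)
  have deriv: "partial_deriv e (\<lambda>y. c * l y ^ m) = (\<lambda>y. (c * of_nat m * l e) * l y ^ (m - 1))" for e c m
  proof
    fix y
    have "(l has_derivative l) (at y)"
      unfolding l_def by (auto intro!: derivative_eq_intros)
    then show "partial_deriv e (\<lambda>y. c * l y ^ m) y = (c * of_nat m * l e) * l y ^ (m - 1)"
      by (intro trans[OF partial_deriv_eqI]) (auto intro!: derivative_eq_intros simp: mult_ac)
  qed
  have null: "(\<Sum>e\<in>Basis. l e * l e) = 0"
  proof -
    have "(\<Sum>e\<in>Basis. l e * l e) = (\<Sum>e\<in>Basis. (if e = a then 1 else 0) - (if e = b then 1 else 0))"
      using ab by (intro sum.cong refl) (auto simp: l_def inner_Basis)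
    also have "\<dots> = 0"
      using ab by (simp add: sum_subtractf)
    finally show ?thesis .
  qed
  have "(\<lambda>y. l y ^ m) \<in> homogeneous_harmonic_polynomials m" for m
  proof -
    have "partial_deriv e (\<lambda>y. l y ^ m) = (\<lambda>y. (of_nat m * l e) * l y ^ (m - 1))" for e
      using deriv[of e 1 m] by simp
    then have "partial_deriv e (partial_deriv e (\<lambda>y. l y ^ m)) =
        (\<lambda>y. (of_nat m * l e * of_nat (m - 1) * l e) * l y ^ (m - 1 - 1))" for e
      by (simp only: deriv)
    then have "laplacian (\<lambda>y. l y ^ m) x =
        (\<Sum>e\<in>Basis. (l e * l e) * (of_nat m * of_nat (m - 1) * l x ^ (m - 1 - 1)))" for x
      by (simp add: laplacian_def mult_ac)
    then have "laplacian (\<lambda>y. l y ^ m) x = 0" for x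
      by (simp only: sum_distrib_right[symmetric] null mult_zero_left)
    moreover have "l (c *\<^sub>R x) ^ m = of_real (c ^ m) * l x ^ m" for c x
      by (simp add: l_def algebra_simps flip: power_mult_distrib)
    ultimately show ?thesis
      by (simp add: homogeneous_harmonic_polynomials_def polynomial_function_power[OF poly])
  qed
  moreover have "l a \<noteq> 0"
    using ab by (simp add: l_def inner_Basis)
  ultimately show ?thesis using that by blast
qed

lemma integrable_gauss_powr:
  fixes f :: "real ^ 'n \<Rightarrow> complex"
  assumes f: "polynomial_function f" and "s > 0" "p \<ge> 0"
  shows "integrable lborel (\<lambda>y. exp (- (s * (norm y)\<^sup>2)) * norm (f y) powr p)"
proof -
  obtain C a where C: "C \<ge> 0" "a \<ge> 0" "\<And>x. norm (f x) \<le> C * exp (a * norm x)"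
    using polynomial_function_exp_bound[OF f] by blast
  have [measurable]: "f \<in> borel_measurable borel"
    by (rule borel_measurable_polynomial_function[OF f])
  have "integrable lborel (\<lambda>y. exp (- (s * (norm y)\<^sup>2)) *\<^sub>R (norm (f y) powr p))"
  proof (rule integrable_gauss[OF _ _ \<open>s > 0\<close>])
    fix y
    have "norm (f y) powr p \<le> (C * exp (a * norm y)) powr p"
      using C \<open>p \<ge> 0\<close> by (intro powr_mono2) auto
    also have "\<dots> = C powr p * exp ((a * p) * norm y)"
      using C by (simp add: powr_mult exp_powr_real mult_ac)
    finally show "norm (norm (f y) powr p) \<le> C powr p * exp ((a * p) * norm y)"
      by simp
  qed measurable
  then show ?thesis by simp
qed

lemma power_powr_commute:
  fixes a p :: real
  assumes "a > 0"
  shows "(a ^ m) powr p = (a powr p) ^ m"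
  using assms by (simp add: powr_realpow[symmetric] powr_powr mult.commute)

text \<open>Comparing both sides of the norm inequality on the powers of the linear form, all constants
  that do not depend on the degree disappear as the degree tends to infinity.\<close>

lemma bounded_imp_growth_le:
  fixes \<alpha> \<beta> p t :: real
  assumes n: "CARD('n::finite) \<ge> 2" and \<alpha>: "\<alpha> > 0" and \<beta>: "\<beta> > 0" and p: "1 \<le> p"
    and bdd: "harmonic_Fock_projection_bounded \<alpha> p (gauss_measure \<beta> :: (real ^ 'n) measure)"
    and t1: "1 + \<alpha> * t > 0" and t2: "1 + p * \<beta> * t > 0"
  shows "1 + p * \<beta> * t \<le> (1 + \<alpha> * t)\<^sup>2"
proof -
  obtain l :: "real ^ 'n \<Rightarrow> complex" and x0 where
    l: "\<And>m. (\<lambda>y. l y ^ m) \<in> homogeneous_harmonic_polynomials m" and x0: "l x0 \<noteq> 0"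
    using power_harmonic[OF n] by blast
  have poly: "polynomial_function (\<lambda>y. l y ^ m)" for m
    by (rule homogeneous_harmonic_polynomialsD(1)[OF l])
  then have [measurable]: "(\<lambda>y. l y ^ m) \<in> borel_measurable borel" for m
    by (rule borel_measurable_polynomial_function)
  obtain C where C: "\<And>f. f \<in> Lp_functions p (gauss_measure \<beta> :: (real ^ 'n) measure) \<Longrightarrow>
      (\<integral>x. norm (harmonic_Fock_projection \<alpha> f x) powr p \<partial>gauss_measure \<beta>)
        \<le> C * (\<integral>x. norm (f x) powr p \<partial>gauss_measure \<beta>)"
    using bdd unfolding harmonic_Fock_projection_bounded_def by blast
  define K where "K = (pi * \<alpha>) powr (- real CARD('n) / 2) * gauss_moment TYPE('n) 0 *
      sqrt (\<alpha> / (1 + \<alpha> * t)) ^ CARD('n)"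
  define A where "A = 1 / (1 + \<alpha> * t)"
  define r where "r = 1 / sqrt (1 + p * \<beta> * t)"
  have K: "K > 0"
    unfolding K_def using \<alpha> t1 gauss_moment_pos[where 'n='n, of 0] by simp
  have A: "A > 0" and r: "r > 0" and r2: "r\<^sup>2 = 1 / (1 + p * \<beta> * t)"
    using t1 t2 by (simp_all add: A_def r_def power_divide)
  define \<sigma> where "\<sigma> = 1 / \<beta> + p * t"
  have \<sigma>: "\<sigma> = (1 + p * \<beta> * t) / \<beta>"
    using \<beta> by (simp add: \<sigma>_def field_simps)
  have \<sigma>_pos: "\<sigma> > 0"
    using \<beta> t2 by (simp add: \<sigma>)
  have \<sigma>r: "\<sigma> * r\<^sup>2 = 1 / \<beta>"
    using t2 by (simp add: \<sigma> r2)
  define I where "I = (\<lambda>m s. \<integral>y. exp (- (s * (norm y)\<^sup>2)) * norm (l y ^ m) powr p \<partial>lborel)"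
  have main: "K powr p * (A powr p) ^ m \<le> (C * r ^ CARD('n)) * (r powr p) ^ m" for m
  proof -
    define f where "f = (\<lambda>y. exp (- (t * (norm y)\<^sup>2)) *\<^sub>R l y ^ m)"
    have [measurable]: "f \<in> borel_measurable borel"
      unfolding f_def by measurable
    have norm_f: "norm (f y) powr p = exp (- (p * t * (norm y)\<^sup>2)) * norm (l y ^ m) powr p" for y
      by (simp add: f_def powr_mult exp_powr_real norm_power mult_ac)
    have weight: "exp (- (norm y)\<^sup>2 / \<beta>) *\<^sub>R (norm (f y) powr p) =
        exp (- (\<sigma> * (norm y)\<^sup>2)) * norm (l y ^ m) powr p" for y
      unfolding norm_f by (simp add: \<sigma>_def exp_add[symmetric] distrib_right)
    have "f \<in> Lp_functions p (gauss_measure \<beta>)"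
    proof -
      have "integrable lborel (\<lambda>y. exp (- (norm y)\<^sup>2 / \<beta>) *\<^sub>R (norm (f y) powr p))"
        unfolding weight using p by (intro integrable_gauss_powr poly \<sigma>_pos) auto
      then show ?thesis
        unfolding Lp_functions_def by (auto intro!: integrable_gauss_measure cong: measurable_cong_sets)
    qed
    note C[OF this]
    moreover define c where "c = (pi * \<beta>) powr (- real CARD('n) / 2)"
    have c: "c > 0"
      using \<beta> by (simp add: c_def)
    have "(\<integral>x. norm (f x) powr p \<partial>gauss_measure \<beta>) = c * I m \<sigma>"
    proof -
      have "(\<lambda>x. norm (f x) powr p) \<in> borel_measurable borel"
        by measurable
      from integral_gauss_measure[OF this, of \<beta>] show ?thesis
        unfolding weight I_def c_def by simp
    qed
    moreover have "harmonic_Fock_projection \<alpha> f x = of_real (K * A ^ m) * l x ^ m" for x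
      unfolding f_def harmonic_Fock_projection_gaussian[OF l \<alpha> t1] K_def A_def by simp
    then have "norm (harmonic_Fock_projection \<alpha> f x) powr p =
        (K powr p * (A powr p) ^ m) * norm (l x ^ m) powr p" for x
      using K A by (simp add: norm_mult powr_mult norm_power power_powr_commute)
    then have "(\<integral>x. norm (harmonic_Fock_projection \<alpha> f x) powr p \<partial>gauss_measure \<beta>) =
        (K powr p * (A powr p) ^ m) * (c * I m (1 / \<beta>))"
      by (simp add: integral_gauss_measure I_def c_def)
    moreover have "I m \<sigma> = r ^ CARD('n) * (r powr p) ^ m * I m (1 / \<beta>)"
    proof -
      have "l (r *\<^sub>R y) ^ m = of_real (r ^ m) * l y ^ m" for y
        using homogeneous_harmonic_polynomialsD(2)[OF l] .
      then have "norm (l (r *\<^sub>R y) ^ m) powr p = (r powr p) ^ m * norm (l y ^ m) powr p" for y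
        using r by (simp add: norm_mult powr_mult norm_power power_powr_commute)
      moreover have "\<sigma> * (norm (r *\<^sub>R y))\<^sup>2 = 1 / \<beta> * (norm y)\<^sup>2" for y :: "real ^ 'n"
        by (simp add: power_mult_distrib \<sigma>r[symmetric])
      moreover have "I m \<sigma> = r ^ CARD('n) *\<^sub>R (\<integral>y. exp (- (\<sigma> * (norm (r *\<^sub>R y))\<^sup>2)) *
          norm (l (r *\<^sub>R y) ^ m) powr p \<partial>lborel)"
        unfolding I_def by (subst integral_lborel_scale[OF _ r]) (auto intro: borel_measurable_times)
      ultimately show ?thesis
        by (simp add: I_def mult_ac)
    qed
    moreover have "I m (1 / \<beta>) > 0"
      unfolding I_def
    proof (rule integral_lborel_pos)
      show "integrable lborel (\<lambda>y. exp (- (1 / \<beta> * (norm y)\<^sup>2)) * norm (l y ^ m) powr p)"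
        using \<beta> p by (intro integrable_gauss_powr poly) auto
      show "continuous_on UNIV (\<lambda>y. exp (- (1 / \<beta> * (norm y)\<^sup>2)) * norm (l y ^ m) powr p)"
        using p by (intro continuous_intros continuous_on_powr' continuous_on_polymonial_function poly) auto
      show "exp (- (1 / \<beta> * (norm x0)\<^sup>2)) * norm (l x0 ^ m) powr p > 0"
        using x0 by simp
    qed simp
    ultimately have "(K powr p * (A powr p) ^ m) * (c * I m (1 / \<beta>)) \<le>
        ((C * r ^ CARD('n)) * (r powr p) ^ m) * (c * I m (1 / \<beta>))" and "c * I m (1 / \<beta>) > 0"
      using c by (simp_all add: mult_ac)
    then show ?thesis
      by (simp only: mult_le_cancel_right_pos)
  qed
  \<comment> \<open>Otherwise the ratio of the powers in \<open>main\<close> grows without bound as \<open>m\<close> increases.\<close>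
  have "A \<le> r"
  proof (rule ccontr)
    assume "\<not> A \<le> r"
    then have "A powr p > r powr p"
      using r p by (intro powr_less_mono2) auto
    then have gt: "A powr p / r powr p > 1"
      using r by simp
    define B where "B = C * r ^ CARD('n) / K powr p"
    obtain m where "B < (A powr p / r powr p) ^ m"
      using real_arch_pow[OF gt] by blast
    then have "B * (r powr p) ^ m < (A powr p) ^ m"
      using r by (simp add: power_divide pos_less_divide_eq)
    then have "(C * r ^ CARD('n)) * (r powr p) ^ m < K powr p * (A powr p) ^ m"
      using K by (simp add: B_def field_simps)
    with main[of m] show False by linarith
  qed
  then have "A\<^sup>2 \<le> r\<^sup>2"
    using A by (intro power_mono) auto
  then show ?thesis
    using t1 t2 by (simp add: A_def r2 power_divide field_simps)
qed

theorem lemma2p2: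
  fixes \<alpha> \<beta> p :: real
  assumes "CARD('n::finite) \<ge> 2"
    and "\<alpha> > 0" and "\<beta> > 0" and "1 \<le> p"
    and "harmonic_Fock_projection_bounded \<alpha> p (gauss_measure \<beta> :: (real ^ 'n) measure)"
  shows "2 * \<alpha> = p * \<beta>"
proof (rule ccontr)
  assume ne: "2 * \<alpha> \<noteq> p * \<beta>"
  define \<delta> where "\<delta> = 2 * \<alpha> - p * \<beta>"
  have \<delta>: "\<bar>\<delta>\<bar> > 0"
    using ne by (simp add: \<delta>_def)
  have p\<beta>: "p * \<beta> > 0"
    using assms by simp
  \<comment> \<open>\<open>(1 + \<alpha> t)\<^sup>2 - (1 + p \<beta> t) = \<delta> t + \<alpha>\<^sup>2 t\<^sup>2\<close> is negative for small \<open>t\<close> of the sign opposite to \<open>\<delta>\<close>.\<close>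
  define \<epsilon> where "\<epsilon> = min (\<bar>\<delta>\<bar> / (2 * \<alpha>\<^sup>2)) (min (1 / (2 * \<alpha>)) (1 / (2 * (p * \<beta>))))"
  define t where "t = - sgn \<delta> * \<epsilon>"
  have \<epsilon>: "\<epsilon> > 0" "\<alpha>\<^sup>2 * \<epsilon> < \<bar>\<delta>\<bar>" "\<alpha> * \<epsilon> < 1" "p * \<beta> * \<epsilon> < 1"
  proof -
    show "\<epsilon> > 0"
      unfolding \<epsilon>_def using \<delta> \<open>\<alpha> > 0\<close> p\<beta> by (simp add: zero_less_mult_iff)
    have "\<epsilon> \<le> \<bar>\<delta>\<bar> / (2 * \<alpha>\<^sup>2)" "\<epsilon> \<le> 1 / (2 * \<alpha>)" "\<epsilon> \<le> 1 / (2 * (p * \<beta>))"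
      by (simp_all add: \<epsilon>_def)
    then have "\<alpha>\<^sup>2 * \<epsilon> \<le> \<bar>\<delta>\<bar> / 2" "\<alpha> * \<epsilon> \<le> 1 / 2" "p * \<beta> * \<epsilon> \<le> 1 / 2"
      using \<open>\<alpha> > 0\<close> p\<beta> by (simp_all add: field_simps)
    then show "\<alpha>\<^sup>2 * \<epsilon> < \<bar>\<delta>\<bar>" "\<alpha> * \<epsilon> < 1" "p * \<beta> * \<epsilon> < 1"
      using \<delta> by linarith+
  qed
  have abs_t: "\<bar>t\<bar> = \<epsilon>"
    using \<delta> \<epsilon>(1) by (simp add: t_def abs_mult abs_sgn_eq)
  have "\<bar>\<alpha> * t\<bar> < 1" "\<bar>p * \<beta> * t\<bar> < 1"
    using \<epsilon> assms p\<beta> by (simp_all add: abs_mult abs_t)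
  then have "1 + \<alpha> * t > 0" "1 + p * \<beta> * t > 0"
    by linarith+
  from bounded_imp_growth_le[OF assms this]
  have "0 \<le> \<delta> * t + \<alpha>\<^sup>2 * t\<^sup>2"
    by (simp add: \<delta>_def power2_eq_square algebra_simps)
  also have "\<delta> * t = - \<bar>\<delta>\<bar> * \<epsilon>"
    by (simp add: t_def abs_sgn)
  also have "t\<^sup>2 = \<epsilon> * \<epsilon>"
    using abs_t by (metis power2_abs power2_eq_square)
  also have "- \<bar>\<delta>\<bar> * \<epsilon> + \<alpha>\<^sup>2 * (\<epsilon> * \<epsilon>) = \<epsilon> * (\<alpha>\<^sup>2 * \<epsilon> - \<bar>\<delta>\<bar>)"
    by (simp add: algebra_simps)
  also have "\<dots> < 0"
    using \<epsilon> by (intro mult_pos_neg) auto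
  finally show False by simp
qed

end
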